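(* Let $k$ be a field, $X$ a set, $G\subseteq\mathrm{Sym}(X)$ an oligomorphic permutation group, $\mu$ a measure on $G$ with values in $k$, $r\ge1$ an integer, and $Y$ a smooth and orbit-finite $G$-set. Then the operators $E_{ij}$ ($1\le i,j\le r$) on $(k^r)^{\otimes Y}$ defined from $\mu$ in the context are well-defined (the defining formula does not depend on the choices made and yields elements of $(k^r)^{\otimes Y}$), and they give an action of the Lie algebra $\mathfrak{gl}_r(k)$ on $(k^r)^{\otimes Y}$ (the elementary matrix $E_{ij}$ acting by the operator $E_{ij}$), which commutes with the action of $G$. In particular there is an induced action of $\mathfrak{gl}_r(k)$ on the space of invariants $\big((k^r)^{\otimes Y}\big)^G$.
   Context: Oligomorphic groups. A subgroup $G\subseteq \mathrm{Sym}(X)$ is oligomorphic if $G$ has finitely many orbits on $X^n$ for all $n\ge 0$. $G$ carries the pointwise convergence topology, whose basic open sets are $\{g\in G\mid gx_i=x_i',\ i=1,\dots,n\}$ for $x_i,x_i'\in X$; a subgroup is open iff it contains the pointwise stabilizer of some finite subset of $X$. For an open subgroup $U\subseteq G$, a $U$-set is smooth if all point stabilizers are open, and orbit-finite if it has finitely many orbits. $\hat G$-sets. A $\hat G$-set is a set $Z$ with a smooth, orbit-finite action of some open subgroup $U\subseteq G$; shrinking $U$ does not change the $\hat G$-set (so an isomorphism of $\hat G$-sets is a bijection equivariant under some open subgroup). A $\hat G$-subset of a smooth $G$-set $Y$ is a subset stable under some open subgroup of $G$. Measures. A measure on $G$ with values in $k$ assigns to each $\hat G$-set $Z$ an element $\mu(Z)\in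 k$ such that: (i) $\mu(Z_1)=\mu(Z_2)$ if $Z_1\cong Z_2$; (ii) $\mu(\{\mathrm{pt}\})=1$; (iii) $\mu(Z^g)=\mu(Z)$ for all $g\in G$, where $Z^g$ is $Z$ with the action conjugated by $g$; (iv) $\mu(Z_1)=\mu(f^{-1}(z))\,\mu(Z_2)$ for every homomorphism $f\colon Z_1\to Z_2$ of transitive smooth $U$-sets ($U\subseteq G$ an open subgroup) and $z\in Z_2$; (v) $\mu(Z_1\sqcup Z_2)=\mu(Z_1)+\mu(Z_2)$. Tensor power. $\mathrm{Part}_r(Y)$ is the $G$-set of $r$-tuples $(Y_1,\dots,Y_r)$ of pairwise disjoint (possibly empty) $\hat G$-subsets of $Y$ with $\bigcup_i Y_i=Y$, with componentwise $G$-action. For a smooth $G$-set $W$, the Schwartz space $\mathcal{S}(W)$ is the space of functions $v\colon W\to k$ that are invariant under some open subgroup of $G$, with $G$-action $(gv)(w)=v(g^{-1}w)$. Set $(k^r)^{\otimes Y}:=\mathcal{S}(\mathrm{Part}_r(Y))$. Operators. For $i\ne j$, $\varphi\in (k^r)^{\otimes Y}$ and $P=(Y_1,\dots,Y_r)\in\mathrm{Part}_r(Y)$, let $P_{y}$ (for $y\in Y_i$) be the tuple obtained from $P$ by removing $y$ from $Y_i$ and adding it to $Y_j$. Choose an open subgroup $U\subseteq G$ fixing $\varphi$ and stabilizing each $Y_a$, decompose $Y_i$ into its finitely many $U$-orbits $O_1,\dots,O_s$, choose $y_t\in O_t$, and put $(E_{ij}\varphi)(P):=\sum_{t=1}^s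 \mu(O_t)\,\varphi(P_{y_t})$. On the indicator function $v_P$ of a single $P=(Y_1,\dots,Y_r)$ this is the formal sum, over $y\in Y_j$, of the indicator functions of the tuples obtained by moving $y$ from $Y_j$ to $Y_i$. For $i=j$: $(E_{ii}\varphi)(P):=\mu(Y_i)\varphi(P)$. *)

theory Defs
  imports
    "HOL-Analysis.Analysis"
    "HOL-Algebra.Group_Action"
    "HOL-Library.Function_Algebras"
    "HOL-Library.Disjoint_Sets"
begin

section \<open>Oligomorphic groups and their topology\<close>

text \<open>
  Permutations of a set \<open>X\<close> are the elements of the library group \<open>BijGroup X\<close>, i.e. bijections of
  \<open>X\<close> that take the value \<open>undefined\<close> outside \<open>X\<close>.
\<close>

definition perm_group :: "'x set \<Rightarrow> ('x \<Rightarrow> 'x) set \<Rightarrow> ('x \<Rightarrow> 'x) monoid" where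
  "perm_group X G = (BijGroup X)\<lparr>carrier := G\<rparr>"

definition oligomorphic :: "'x set \<Rightarrow> ('x \<Rightarrow> 'x) set \<Rightarrow> bool" where
  "oligomorphic X G \<longleftrightarrow> subgroup G (BijGroup X) \<and>
     (\<forall>n. finite (orbits (perm_group X G) {xs. length xs = n \<and> set xs \<subseteq> X} map))"

definition pointwise_topology :: "'x set \<Rightarrow> ('x \<Rightarrow> 'x) set \<Rightarrow> ('x \<Rightarrow> 'x) topology" where
  "pointwise_topology X G =
     topology_generated_by {{g \<in> G. \<forall>(x, x') \<in> S. g x = x'} | S. finite S \<and> S \<subseteq> X \<times> X}"

definition open_subgroup :: "'x set \<Rightarrow> ('x \<Rightarrow> 'x) set \<Rightarrow> ('x \<Rightarrow> 'x) set \<Rightarrow> bool" where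
  "open_subgroup X G U \<longleftrightarrow>
     subgroup U (perm_group X G) \<and> openin (pointwise_topology X G) U"

lemma openin_pointwise_topology_nbhd:
  assumes "subgroup G (BijGroup X)" "openin (pointwise_topology X G) W" "g \<in> W"
  shows "\<exists>A. finite A \<and> A \<subseteq> X \<and> {h \<in> G. \<forall>x\<in>A. h x = g x} \<subseteq> W"
proof -
  have "generate_topology_on
      {{g \<in> G. \<forall>(x, x') \<in> S. g x = x'} | S. finite S \<and> S \<subseteq> X \<times> X} W"
    using assms(2) unfolding pointwise_topology_def by (rule openin_topology_generated_by)
  then show ?thesis
    using assms(3)
  proof (induction)
    case Empty
    then show ?case by simp
  next
    case (Int a b)
    from Int.prems have g: "g \<in> a" "g \<in> b" by auto
    obtain A where A: "finite A" "A \<subseteq> X" "{h \<in> G. \<forall>x\<in>A. h x = g x} \<subseteq> a"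
      using Int.IH(1)[OF g(1)] by (elim exE conjE)
    obtain B where B: "finite B" "B \<subseteq> X" "{h \<in> G. \<forall>x\<in>B. h x = g x} \<subseteq> b"
      using Int.IH(2)[OF g(2)] by (elim exE conjE)
    have "{h \<in> G. \<forall>x\<in>A \<union> B. h x = g x} \<subseteq>
        {h \<in> G. \<forall>x\<in>A. h x = g x} \<inter> {h \<in> G. \<forall>x\<in>B. h x = g x}"
      by auto
    also have "\<dots> \<subseteq> a \<inter> b"
      using A(3) B(3) by (rule Int_mono)
    finally show ?case
      using A B by (intro exI[of _ "A \<union> B"] conjI) auto
  next
    case (UN K)
    then obtain k where "k \<in> K" "g \<in> k" by blast
    obtain A where A: "finite A" "A \<subseteq> X" "{h \<in> G. \<forall>x\<in>A. h x = g x} \<subseteq> k"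
      using UN.IH[OF \<open>k \<in> K\<close> \<open>g \<in> k\<close>] by (elim exE conjE)
    from \<open>k \<in> K\<close> have "k \<subseteq> \<Union>K" by (rule Union_upper)
    with A(3) have "{h \<in> G. \<forall>x\<in>A. h x = g x} \<subseteq> \<Union>K" by (rule order_trans)
    with A show ?case by (intro exI[of _ A] conjI)
  next
    case (Basis s)
    then obtain S where S: "s = {g \<in> G. \<forall>(x, x') \<in> S. g x = x'}" "finite S" "S \<subseteq> X \<times> X"
      by blast
    have "{h \<in> G. \<forall>x\<in>fst ` S. h x = g x} \<subseteq> s"
      using Basis.prems unfolding S(1) by force
    moreover have "fst ` S \<subseteq> X" using S(3) by auto
    ultimately show ?case using S(2) by (intro exI[of _ "fst ` S"] conjI) auto
  qed
qed

lemma open_subgroup_iff: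
  assumes G: "subgroup G (BijGroup X)"
  shows "open_subgroup X G U \<longleftrightarrow>
     subgroup U (perm_group X G) \<and>
     (\<exists>A. finite A \<and> A \<subseteq> X \<and> {g \<in> G. \<forall>x\<in>A. g x = x} \<subseteq> U)"
proof (intro iffI conjI; (elim conjE)?)
  assume "open_subgroup X G U"
  then have sub: "subgroup U (perm_group X G)" and op: "openin (pointwise_topology X G) U"
    unfolding open_subgroup_def by auto
  show "subgroup U (perm_group X G)" by (rule sub)
  have "(\<lambda>x\<in>X. x) \<in> U"
    using subgroup.one_closed[OF sub] by (simp add: perm_group_def BijGroup_def)
  from openin_pointwise_topology_nbhd[OF G op this]
  obtain A where A: "finite A" "A \<subseteq> X" "{h \<in> G. \<forall>x\<in>A. h x = (\<lambda>x\<in>X. x) x} \<subseteq> U"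
    by (elim exE conjE)
  have "{g \<in> G. \<forall>x\<in>A. g x = x} \<subseteq> {h \<in> G. \<forall>x\<in>A. h x = (\<lambda>x\<in>X. x) x}"
    using A(2) by auto
  also note A(3)
  finally show "\<exists>A. finite A \<and> A \<subseteq> X \<and> {g \<in> G. \<forall>x\<in>A. g x = x} \<subseteq> U"
    using A(1,2) by (intro exI[of _ A] conjI)
next
  assume sub: "subgroup U (perm_group X G)"
    and "\<exists>A. finite A \<and> A \<subseteq> X \<and> {g \<in> G. \<forall>x\<in>A. g x = x} \<subseteq> U"
  then obtain A where A: "finite A" "A \<subseteq> X" "{g \<in> G. \<forall>x\<in>A. g x = x} \<subseteq> U"
    by (elim exE conjE)
  interpret B: group "BijGroup X" by (rule group_BijGroup)
  interpret P: group "perm_group X G"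
    unfolding perm_group_def by (rule B.subgroup_imp_group[OF G])
  interpret U: subgroup U "perm_group X G" by (rule sub)
  have UG: "U \<subseteq> G" using U.subset by (simp add: perm_group_def)
  have GB: "G \<subseteq> Bij X" using subgroup.subset[OF G] by (simp add: BijGroup_def)
  have mult: "(a \<otimes>\<^bsub>perm_group X G\<^esub> b) x = a (b x)" if "a \<in> G" "b \<in> G" "x \<in> X" for a b x
    using that GB by (auto simp: perm_group_def BijGroup_def compose_def subset_iff)
  have nb: "{h \<in> G. \<forall>(x, x') \<in> (\<lambda>x. (x, u x)) ` A. h x = x'} \<subseteq> U" if u: "u \<in> U" for u
  proof
    fix h assume "h \<in> {h \<in> G. \<forall>(x, x') \<in> (\<lambda>x. (x, u x)) ` A. h x = x'}"
    then have h: "h \<in> G" "\<And>x. x \<in> A \<Longrightarrow> h x = u x" by auto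
    let ?w = "inv\<^bsub>perm_group X G\<^esub> u"
    have w: "?w \<in> U" using u by simp
    have "(?w \<otimes>\<^bsub>perm_group X G\<^esub> h) x = x" if "x \<in> A" for x
    proof -
      have "x \<in> X" using that A(2) by blast
      then have "(?w \<otimes>\<^bsub>perm_group X G\<^esub> h) x = ?w (u x)"
        using mult[of ?w h x] subsetD[OF UG w] h(1) h(2)[OF that] by simp
      also have "\<dots> = (?w \<otimes>\<^bsub>perm_group X G\<^esub> u) x"
        using mult[OF subsetD[OF UG w] subsetD[OF UG u] \<open>x \<in> X\<close>] by (rule sym)
      also have "?w \<otimes>\<^bsub>perm_group X G\<^esub> u = \<one>\<^bsub>perm_group X G\<^esub>"
        using u U.mem_carrier by (intro P.l_inv) auto
      also have "\<one>\<^bsub>perm_group X G\<^esub> x = x"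
        using \<open>x \<in> X\<close> by (simp add: perm_group_def BijGroup_def)
      finally show ?thesis .
    qed
    moreover have hc: "h \<in> carrier (perm_group X G)" using h by (simp add: perm_group_def)
    then have "?w \<otimes>\<^bsub>perm_group X G\<^esub> h \<in> carrier (perm_group X G)"
      using w U.mem_carrier by auto
    ultimately have "?w \<otimes>\<^bsub>perm_group X G\<^esub> h \<in> U"
      using A(3) by (auto simp: perm_group_def)
    then have "u \<otimes>\<^bsub>perm_group X G\<^esub> (?w \<otimes>\<^bsub>perm_group X G\<^esub> h) \<in> U" using u by simp
    also have "u \<otimes>\<^bsub>perm_group X G\<^esub> (?w \<otimes>\<^bsub>perm_group X G\<^esub> h) = h"
      using u hc U.mem_carrier by (simp add: P.m_assoc[symmetric] P.r_inv)
    finally show "h \<in> U" .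
  qed
  have "U = (\<Union>u\<in>U. {h \<in> G. \<forall>(x, x') \<in> (\<lambda>x. (x, u x)) ` A. h x = x'})"
    using nb UG by auto
  moreover have "openin (pointwise_topology X G)
      {h \<in> G. \<forall>(x, x') \<in> (\<lambda>x. (x, u x)) ` A. h x = x'}" if "u \<in> U" for u
    unfolding pointwise_topology_def
  proof (rule topology_generated_by_Basis, intro CollectI exI conjI)
    show "{h \<in> G. \<forall>(x, x') \<in> (\<lambda>x. (x, u x)) ` A. h x = x'} =
      {h \<in> G. \<forall>(x, x') \<in> (\<lambda>x. (x, u x)) ` A. h x = x'}" ..
    have "u \<in> Bij X" using that UG GB by blast
    then show "(\<lambda>x. (x, u x)) ` A \<subseteq> X \<times> X" using A(2) Bij_imp_funcset by fastforce
  qed (use A in auto)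
  ultimately have "openin (pointwise_topology X G) U"
    by (metis (no_types, lifting) imageE openin_Union)
  then show "open_subgroup X G U" unfolding open_subgroup_def using sub by simp
qed


section \<open>G-hat-sets\<close>

text \<open>
  A G-hat-set is given by an open subgroup \<open>U\<close>, a set \<open>Z\<close> and an action \<open>\<alpha>\<close> of \<open>U\<close> on \<open>Z\<close>.  That the
  choice of \<open>U\<close> is immaterial is built into the notion of isomorphism.  The values of \<open>\<alpha>\<close> outside
  \<open>U\<close> are irrelevant.
\<close>

definition ghat_set ::
  "'x set \<Rightarrow> ('x \<Rightarrow> 'x) set \<Rightarrow> ('x \<Rightarrow> 'x) set \<Rightarrow> 'z set \<Rightarrow> (('x \<Rightarrow> 'x) \<Rightarrow> 'z \<Rightarrow> 'z) \<Rightarrow> bool" where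
  "ghat_set X G U Z \<alpha> \<longleftrightarrow>
     open_subgroup X G U \<and>
     group_action (perm_group X U) Z \<alpha> \<and>
     (\<forall>z\<in>Z. open_subgroup X G (stabilizer (perm_group X U) \<alpha> z)) \<and>
     finite (orbits (perm_group X U) Z \<alpha>)"

definition ghat_iso ::
  "'x set \<Rightarrow> ('x \<Rightarrow> 'x) set \<Rightarrow>
   ('x \<Rightarrow> 'x) set \<Rightarrow> 'z set \<Rightarrow> (('x \<Rightarrow> 'x) \<Rightarrow> 'z \<Rightarrow> 'z) \<Rightarrow>
   ('x \<Rightarrow> 'x) set \<Rightarrow> 'w set \<Rightarrow> (('x \<Rightarrow> 'x) \<Rightarrow> 'w \<Rightarrow> 'w) \<Rightarrow> bool" where
  "ghat_iso X G U1 Z1 \<alpha>1 U2 Z2 \<alpha>2 \<longleftrightarrow>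
     (\<exists>V f. open_subgroup X G V \<and> V \<subseteq> U1 \<inter> U2 \<and> bij_betw f Z1 Z2 \<and>
        (\<forall>g\<in>V. \<forall>z\<in>Z1. f (\<alpha>1 g z) = \<alpha>2 g (f z)))"

definition stable_under :: "('x \<Rightarrow> 'x) set \<Rightarrow> (('x \<Rightarrow> 'x) \<Rightarrow> 'z \<Rightarrow> 'z) \<Rightarrow> 'z set \<Rightarrow> bool" where
  "stable_under U \<alpha> S \<longleftrightarrow> (\<forall>g\<in>U. \<alpha> g ` S = S)"

text \<open>Restriction of an action to a stable subset; actions in the library are extensional.\<close>

definition restrict_action :: "('g \<Rightarrow> 'z \<Rightarrow> 'z) \<Rightarrow> 'z set \<Rightarrow> 'g \<Rightarrow> 'z \<Rightarrow> 'z" where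
  "restrict_action \<alpha> S = (\<lambda>g. restrict (\<alpha> g) S)"

definition conj_subgroup :: "'x set \<Rightarrow> ('x \<Rightarrow> 'x) \<Rightarrow> ('x \<Rightarrow> 'x) set \<Rightarrow> ('x \<Rightarrow> 'x) set" where
  "conj_subgroup X g U = (\<lambda>u. g \<otimes>\<^bsub>BijGroup X\<^esub> u \<otimes>\<^bsub>BijGroup X\<^esub> inv\<^bsub>BijGroup X\<^esub> g) ` U"

definition conj_action ::
  "'x set \<Rightarrow> ('x \<Rightarrow> 'x) \<Rightarrow> (('x \<Rightarrow> 'x) \<Rightarrow> 'z \<Rightarrow> 'z) \<Rightarrow> ('x \<Rightarrow> 'x) \<Rightarrow> 'z \<Rightarrow> 'z" where
  "conj_action X g \<alpha> = (\<lambda>h. \<alpha> (inv\<^bsub>BijGroup X\<^esub> g \<otimes>\<^bsub>BijGroup X\<^esub> h \<otimes>\<^bsub>BijGroup X\<^esub> g))"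

text \<open>The library's \<open>transitive_action\<close> allows the empty set.\<close>

definition transitive_smooth_set ::
  "'x set \<Rightarrow> ('x \<Rightarrow> 'x) set \<Rightarrow> ('x \<Rightarrow> 'x) set \<Rightarrow> 'z set \<Rightarrow> (('x \<Rightarrow> 'x) \<Rightarrow> 'z \<Rightarrow> 'z) \<Rightarrow> bool" where
  "transitive_smooth_set X G U Z \<alpha> \<longleftrightarrow>
     ghat_set X G U Z \<alpha> \<and> transitive_action (perm_group X U) Z \<alpha> \<and> Z \<noteq> {}"


section \<open>Measures\<close>

text \<open>
  A function on all G-hat-sets cannot be a single HOL function, since the points may be of any type.
  A measure is therefore a function on the G-hat-sets whose points belong to a fixed type that
  contains an isomorphic copy of every G-hat-set (lemma \<open>ghat_set_has_copy\<close>): a G-hat-set is a finite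
  disjoint union of coset spaces, and a point of it is encoded by the number of its orbit together
  with a coset.  By isomorphism invariance such a function has exactly one isomorphism invariant
  extension to G-hat-sets over an arbitrary type, which is \<open>ghat_value\<close>.
\<close>

type_synonym 'x ghat_point = "nat \<times> ('x \<Rightarrow> 'x) set"

type_synonym ('x, 'k) ghat_function =
  "('x \<Rightarrow> 'x) set \<Rightarrow> 'x ghat_point set \<Rightarrow>
   (('x \<Rightarrow> 'x) \<Rightarrow> 'x ghat_point \<Rightarrow> 'x ghat_point) \<Rightarrow> 'k"

text \<open>
  In \<open>additive\<close> both summands are acted on by the same group, which is no restriction since any two
  G-hat-sets can be restricted to a common open subgroup.
\<close>

locale ghat_measure =
  fixes X :: "'x set" and G :: "('x \<Rightarrow> 'x) set" and \<mu> :: "('x, 'k::field) ghat_function"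
  assumes iso_invariant:
      "\<lbrakk>ghat_set X G U1 Z1 \<alpha>1; ghat_set X G U2 Z2 \<alpha>2; ghat_iso X G U1 Z1 \<alpha>1 U2 Z2 \<alpha>2\<rbrakk>
       \<Longrightarrow> \<mu> U1 Z1 \<alpha>1 = \<mu> U2 Z2 \<alpha>2"
    and point: "ghat_set X G U {z} \<alpha> \<Longrightarrow> \<mu> U {z} \<alpha> = 1"
    and conj_invariant:
      "\<lbrakk>ghat_set X G U Z \<alpha>; g \<in> G\<rbrakk>
       \<Longrightarrow> \<mu> (conj_subgroup X g U) Z (conj_action X g \<alpha>) = \<mu> U Z \<alpha>"
    and fibration:
      "\<lbrakk>transitive_smooth_set X G U Z1 \<alpha>1; transitive_smooth_set X G U Z2 \<alpha>2;
        f \<in> Z1 \<rightarrow> Z2; \<forall>g\<in>U. \<forall>w\<in>Z1. f (\<alpha>1 g w) = \<alpha>2 g (f w); z \<in> Z2\<rbrakk>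
       \<Longrightarrow> \<mu> U Z1 \<alpha>1 =
           \<mu> (stabilizer (perm_group X U) \<alpha>2 z) {w \<in> Z1. f w = z}
             (restrict_action \<alpha>1 {w \<in> Z1. f w = z}) * \<mu> U Z2 \<alpha>2"
    and additive:
      "\<lbrakk>ghat_set X G U (Z1 \<union> Z2) \<alpha>; Z1 \<inter> Z2 = {}; stable_under U \<alpha> Z1; stable_under U \<alpha> Z2\<rbrakk>
       \<Longrightarrow> \<mu> U (Z1 \<union> Z2) \<alpha> =
           \<mu> U Z1 (restrict_action \<alpha> Z1) + \<mu> U Z2 (restrict_action \<alpha> Z2)"

definition ghat_value ::
  "'x set \<Rightarrow> ('x \<Rightarrow> 'x) set \<Rightarrow> ('x, 'k) ghat_function \<Rightarrow>
   ('x \<Rightarrow> 'x) set \<Rightarrow> 'z set \<Rightarrow> (('x \<Rightarrow> 'x) \<Rightarrow> 'z \<Rightarrow> 'z) \<Rightarrow> 'k" where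
  "ghat_value X G \<mu> U Z \<alpha> =
     (THE c. \<exists>U' Z' \<alpha>'. ghat_set X G U' Z' \<alpha>' \<and> ghat_iso X G U Z \<alpha> U' Z' \<alpha>' \<and> c = \<mu> U' Z' \<alpha>')"

lemma ghat_set_transport:
  fixes e :: "'z \<Rightarrow> 'w"
  assumes Z: "ghat_set X G U Z \<alpha>" and inj: "inj_on e Z"
  defines "\<beta> \<equiv> (\<lambda>g. restrict (\<lambda>w. e (\<alpha> g (inv_into Z e w))) (e ` Z))"
  shows "ghat_set X G U (e ` Z) \<beta>" and "ghat_iso X G U Z \<alpha> U (e ` Z) \<beta>"
proof -
  from Z have U: "open_subgroup X G U" and act: "group_action (perm_group X U) Z \<alpha>"
    and st: "\<And>z. z \<in> Z \<Longrightarrow> open_subgroup X G (stabilizer (perm_group X U) \<alpha> z)"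
    and fin: "finite (orbits (perm_group X U) Z \<alpha>)"
    unfolding ghat_set_def by auto
  interpret A: group_action "perm_group X U" Z \<alpha> by (rule act)
  interpret H: group_hom "perm_group X U" "BijGroup Z" \<alpha> by (rule A.group_hom)
  have car [simp]: "carrier (perm_group X U) = U" by (simp add: perm_group_def)
  have cl: "\<alpha> g z \<in> Z" if "g \<in> U" "z \<in> Z" for g z
    using A.element_image[of g z] that by simp
  have b: "\<beta> g (e z) = e (\<alpha> g z)" if "z \<in> Z" for g z
    using that inj by (simp add: \<beta>_def)
  have Bij: "\<beta> g \<in> Bij (e ` Z)" if "g \<in> U" for g
  proof -
    have "bij_betw (\<alpha> g) Z Z" using A.bij_prop0[of g] that by (simp add: Bij_def)
    moreover have "bij_betw e Z (e ` Z)" using inj by (simp add: inj_on_imp_bij_betw)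
    ultimately have "bij_betw (e \<circ> \<alpha> g \<circ> inv_into Z e) (e ` Z) (e ` Z)"
      by (meson bij_betw_inv_into bij_betw_trans)
    then have "bij_betw (\<beta> g) (e ` Z) (e ` Z)"
      by (rule bij_betw_cong[THEN iffD1, rotated]) (simp add: \<beta>_def)
    then show ?thesis by (simp add: Bij_def \<beta>_def)
  qed
  have mult: "\<beta> (g \<otimes>\<^bsub>perm_group X U\<^esub> h) = \<beta> g \<otimes>\<^bsub>BijGroup (e ` Z)\<^esub> \<beta> h"
    if "g \<in> U" "h \<in> U" for g h
  proof
    fix w
    have "\<beta> g \<otimes>\<^bsub>BijGroup (e ` Z)\<^esub> \<beta> h = compose (e ` Z) (\<beta> g) (\<beta> h)"
      using Bij that by (simp add: BijGroup_def)
    moreover have "\<beta> (g \<otimes>\<^bsub>perm_group X U\<^esub> h) w = compose (e ` Z) (\<beta> g) (\<beta> h) w"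
    proof (cases "w \<in> e ` Z")
      case True
      then obtain z where z: "z \<in> Z" "w = e z" by blast
      have "\<alpha> (g \<otimes>\<^bsub>perm_group X U\<^esub> h) z = \<alpha> g (\<alpha> h z)"
        using A.composition_rule[of z g h] z that by simp
      then show ?thesis
        using z that cl[of h z] by (simp add: b compose_def del: H.hom_mult)
    qed (simp add: \<beta>_def compose_def)
    ultimately show "\<beta> (g \<otimes>\<^bsub>perm_group X U\<^esub> h) w = (\<beta> g \<otimes>\<^bsub>BijGroup (e ` Z)\<^esub> \<beta> h) w"
      by simp
  qed
  have "group_action (perm_group X U) (e ` Z) \<beta>"
    unfolding group_action_def group_hom_def group_hom_axioms_def hom_def
    using Bij mult by (auto simp: group_BijGroup H.G.is_group) (simp add: BijGroup_def)
  moreover have "stabilizer (perm_group X U) \<beta> (e z) = stabilizer (perm_group X U) \<alpha> z"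
    if "z \<in> Z" for z
    using that cl inj by (auto simp: stabilizer_def b inj_on_eq_iff)
  moreover have "orbit (perm_group X U) \<beta> (e z) = e ` orbit (perm_group X U) \<alpha> z" if "z \<in> Z" for z
    using that by (auto simp: orbit_def b)
  then have "orbits (perm_group X U) (e ` Z) \<beta> = (\<lambda>C. e ` C) ` orbits (perm_group X U) Z \<alpha>"
    by (auto simp: orbits_def image_iff)
  ultimately show "ghat_set X G U (e ` Z) \<beta>"
    unfolding ghat_set_def using U st fin by auto
  show "ghat_iso X G U Z \<alpha> U (e ` Z) \<beta>"
    unfolding ghat_iso_def using U inj b
    by (intro exI[of _ U] exI[of _ e]) (auto simp: inj_on_imp_bij_betw)
qed

lemma ghat_set_has_copy:
  fixes X :: "'x set" and Z :: "'z set"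
  assumes Z: "ghat_set X G U Z \<alpha>"
  shows "\<exists>(Z' :: 'x ghat_point set) \<alpha>'. ghat_set X G U Z' \<alpha>' \<and> ghat_iso X G U Z \<alpha> U Z' \<alpha>'"
proof -
  from Z have act: "group_action (perm_group X U) Z \<alpha>"
    and fin: "finite (orbits (perm_group X U) Z \<alpha>)"
    unfolding ghat_set_def by auto
  interpret A: group_action "perm_group X U" Z \<alpha> by (rule act)
  let ?orb = "orbit (perm_group X U) \<alpha>"
  obtain idx :: "'z set \<Rightarrow> nat" where idx: "inj_on idx (orbits (perm_group X U) Z \<alpha>)"
    using fin finite_imp_inj_to_nat_seg by metis
  define r where "r C = (SOME z. z \<in> C)" for C :: "'z set"
  define e where "e z = (idx (?orb z), {g \<in> U. \<alpha> g (r (?orb z)) = z})" for z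
  have "inj_on e Z"
  proof (rule inj_onI)
    fix z w assume zw: "z \<in> Z" "w \<in> Z" "e z = e w"
    then have "idx (?orb z) = idx (?orb w)" by (simp add: e_def)
    then have o: "?orb z = ?orb w"
      using zw idx by (auto simp: inj_on_def orbits_def)
    have "z \<in> ?orb z" using A.orbit_refl zw by blast
    then have rz: "r (?orb z) \<in> ?orb z" unfolding r_def by (rule someI)
    then have "r (?orb z) \<in> Z" "z \<in> ?orb (r (?orb z))"
      using zw A.orbit_sym A.element_image by (auto simp: orbit_def) blast+
    then have "\<exists>g\<in>U. z = \<alpha> g (r (?orb z))"
      unfolding orbit_def[of _ _ "r (?orb z)"] by (auto simp: perm_group_def)
    then obtain g where g: "g \<in> U" "z = \<alpha> g (r (?orb z))"
      by blast
    then have gz: "g \<in> {g \<in> U. \<alpha> g (r (?orb z)) = z}"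
      using g(2)[symmetric] by (intro CollectI conjI)
    from zw have "{g \<in> U. \<alpha> g (r (?orb z)) = z} = {g \<in> U. \<alpha> g (r (?orb z)) = w}"
      using o by (simp add: e_def)
    with gz have "g \<in> {g \<in> U. \<alpha> g (r (?orb z)) = w}" by (rule subst[rotated])
    with g(2) show "z = w" by simp
  qed
  from ghat_set_transport[OF Z this] show ?thesis by blast
qed

lemma ghat_iso_common_source:
  assumes G: "subgroup G (BijGroup X)"
    and Z: "ghat_set X G U Z \<alpha>"
    and 1: "ghat_iso X G U Z \<alpha> U1 Z1 \<alpha>1" and 2: "ghat_iso X G U Z \<alpha> U2 Z2 \<alpha>2"
  shows "ghat_iso X G U1 Z1 \<alpha>1 U2 Z2 \<alpha>2"
proof -
  obtain V f where f: "open_subgroup X G V" "V \<subseteq> U \<inter> U1" "bij_betw f Z Z1"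
    "\<And>g z. g \<in> V \<Longrightarrow> z \<in> Z \<Longrightarrow> f (\<alpha> g z) = \<alpha>1 g (f z)"
    using 1 unfolding ghat_iso_def by metis
  obtain W h where h: "open_subgroup X G W" "W \<subseteq> U \<inter> U2" "bij_betw h Z Z2"
    "\<And>g z. g \<in> W \<Longrightarrow> z \<in> Z \<Longrightarrow> h (\<alpha> g z) = \<alpha>2 g (h z)"
    using 2 unfolding ghat_iso_def by metis
  interpret A: group_action "perm_group X U" Z \<alpha> using Z by (simp add: ghat_set_def)
  have cl: "\<alpha> g z \<in> Z" if "g \<in> U" "z \<in> Z" for g z
    using A.element_image[of g z] that by (simp add: perm_group_def)
  have "group (perm_group X G)"
    unfolding perm_group_def by (rule group.subgroup_imp_group[OF group_BijGroup G])
  then have "open_subgroup X G (V \<inter> W)"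
    using f(1) h(1) unfolding open_subgroup_def by (auto intro: group.subgroups_Inter_pair)
  moreover have "bij_betw (h \<circ> inv_into Z f) Z1 Z2"
    using f(3) h(3) by (meson bij_betw_inv_into bij_betw_trans)
  moreover have "(h \<circ> inv_into Z f) (\<alpha>1 g w) = \<alpha>2 g ((h \<circ> inv_into Z f) w)"
    if g: "g \<in> V \<inter> W" and w: "w \<in> Z1" for g w
  proof -
    obtain z where z: "z \<in> Z" "w = f z" using w f(3) by (auto simp: bij_betw_def)
    have "\<alpha>1 g w = f (\<alpha> g z)" using f(4) g z by simp
    moreover have "\<alpha> g z \<in> Z" using cl g z f(2) by blast
    ultimately show ?thesis using f(3) h(4) g z by (simp add: bij_betw_def)
  qed
  ultimately show ?thesis unfolding ghat_iso_def using f(2) h(2) by blast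
qed

lemma (in ghat_measure) ghat_value_eq:
  assumes "subgroup G (BijGroup X)" "ghat_set X G U Z \<alpha>"
    and "ghat_set X G U' Z' \<alpha>'" "ghat_iso X G U Z \<alpha> U' Z' \<alpha>'"
  shows "ghat_value X G \<mu> U Z \<alpha> = \<mu> U' Z' \<alpha>'"
  unfolding ghat_value_def
  using assms ghat_iso_common_source[OF assms(1,2)] iso_invariant
  by (intro the_equality) blast+


section \<open>Schwartz spaces and tensor powers\<close>

text \<open>Functions on \<open>W\<close> are represented by functions on the whole type that vanish outside \<open>W\<close>.\<close>

definition fun_action ::
  "'x set \<Rightarrow> 'w set \<Rightarrow> (('x \<Rightarrow> 'x) \<Rightarrow> 'w \<Rightarrow> 'w) \<Rightarrow> ('x \<Rightarrow> 'x) \<Rightarrow> ('w \<Rightarrow> 'k::zero) \<Rightarrow> 'w \<Rightarrow> 'k" where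
  "fun_action X W \<alpha> g v = (\<lambda>w. if w \<in> W then v (\<alpha> (inv\<^bsub>BijGroup X\<^esub> g) w) else 0)"

definition schwartz_space ::
  "'x set \<Rightarrow> ('x \<Rightarrow> 'x) set \<Rightarrow> 'w set \<Rightarrow> (('x \<Rightarrow> 'x) \<Rightarrow> 'w \<Rightarrow> 'w) \<Rightarrow> ('w \<Rightarrow> 'k::zero) set" where
  "schwartz_space X G W \<alpha> =
     {v. (\<forall>w. w \<notin> W \<longrightarrow> v w = 0) \<and>
         (\<exists>U. open_subgroup X G U \<and> (\<forall>g\<in>U. fun_action X W \<alpha> g v = v))}"

definition ghat_subset ::
  "'x set \<Rightarrow> ('x \<Rightarrow> 'x) set \<Rightarrow> 'y set \<Rightarrow> (('x \<Rightarrow> 'x) \<Rightarrow> 'y \<Rightarrow> 'y) \<Rightarrow> 'y set \<Rightarrow> bool" where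
  "ghat_subset X G Y \<psi> S \<longleftrightarrow> S \<subseteq> Y \<and> (\<exists>U. open_subgroup X G U \<and> stable_under U \<psi> S)"

text \<open>An \<open>r\<close>-tuple is a function on a finite index type \<open>'r\<close> with \<open>r\<close> elements.\<close>

definition Part ::
  "'x set \<Rightarrow> ('x \<Rightarrow> 'x) set \<Rightarrow> 'y set \<Rightarrow> (('x \<Rightarrow> 'x) \<Rightarrow> 'y \<Rightarrow> 'y) \<Rightarrow> ('r::finite \<Rightarrow> 'y set) set" where
  "Part X G Y \<psi> =
     {P. (\<forall>a. ghat_subset X G Y \<psi> (P a)) \<and> disjoint_family P \<and> (\<Union>a. P a) = Y}"

definition part_action :: "(('x \<Rightarrow> 'x) \<Rightarrow> 'y \<Rightarrow> 'y) \<Rightarrow> ('x \<Rightarrow> 'x) \<Rightarrow> ('r \<Rightarrow> 'y set) \<Rightarrow> 'r \<Rightarrow> 'y set" where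
  "part_action \<psi> g P = (\<lambda>a. \<psi> g ` P a)"

definition tensor_power ::
  "'x set \<Rightarrow> ('x \<Rightarrow> 'x) set \<Rightarrow> 'y set \<Rightarrow> (('x \<Rightarrow> 'x) \<Rightarrow> 'y \<Rightarrow> 'y) \<Rightarrow>
   (('r::finite \<Rightarrow> 'y set) \<Rightarrow> 'k::zero) set" where
  "tensor_power X G Y \<psi> = schwartz_space X G (Part X G Y \<psi>) (part_action \<psi>)"

definition tensor_action ::
  "'x set \<Rightarrow> ('x \<Rightarrow> 'x) set \<Rightarrow> 'y set \<Rightarrow> (('x \<Rightarrow> 'x) \<Rightarrow> 'y \<Rightarrow> 'y) \<Rightarrow>
   ('x \<Rightarrow> 'x) \<Rightarrow> (('r::finite \<Rightarrow> 'y set) \<Rightarrow> 'k::zero) \<Rightarrow> ('r \<Rightarrow> 'y set) \<Rightarrow> 'k" where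
  "tensor_action X G Y \<psi> = fun_action X (Part X G Y \<psi>) (part_action \<psi>)"

definition tensor_invariants ::
  "'x set \<Rightarrow> ('x \<Rightarrow> 'x) set \<Rightarrow> 'y set \<Rightarrow> (('x \<Rightarrow> 'x) \<Rightarrow> 'y \<Rightarrow> 'y) \<Rightarrow>
   (('r::finite \<Rightarrow> 'y set) \<Rightarrow> 'k::zero) set" where
  "tensor_invariants X G Y \<psi> =
     {v \<in> tensor_power X G Y \<psi>. \<forall>g\<in>G. tensor_action X G Y \<psi> g v = v}"


section \<open>The operators\<close>

definition move :: "'r \<Rightarrow> 'r \<Rightarrow> 'y \<Rightarrow> ('r \<Rightarrow> 'y set) \<Rightarrow> 'r \<Rightarrow> 'y set" where
  "move i j y P = P(i := P i - {y}, j := insert y (P j))"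

text \<open>
  \<open>E_value \<dots> i j v P c\<close>: some choice of the open subgroup \<open>U\<close> (and, for \<open>i \<noteq> j\<close>, of a
  representative \<open>y C\<close> of each \<open>U\<close>-orbit \<open>C\<close> in \<open>P i\<close>) yields the value \<open>c\<close> for \<open>(E\<^sub>i\<^sub>j v)(P)\<close>.
  For \<open>i = j\<close> the choice is that of an open subgroup acting on the G-hat-set \<open>P i\<close>.
\<close>

definition E_value ::
  "'x set \<Rightarrow> ('x \<Rightarrow> 'x) set \<Rightarrow> ('x, 'k::field) ghat_function \<Rightarrow> 'y set \<Rightarrow> (('x \<Rightarrow> 'x) \<Rightarrow> 'y \<Rightarrow> 'y) \<Rightarrow>
   'r::finite \<Rightarrow> 'r \<Rightarrow> (('r \<Rightarrow> 'y set) \<Rightarrow> 'k) \<Rightarrow> ('r \<Rightarrow> 'y set) \<Rightarrow> 'k \<Rightarrow> bool" where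
  "E_value X G \<mu> Y \<psi> i j v P c \<longleftrightarrow>
     (if i = j then
        \<exists>U. open_subgroup X G U \<and> stable_under U \<psi> (P i) \<and>
          c = ghat_value X G \<mu> U (P i) (restrict_action \<psi> (P i)) * v P
      else
        \<exists>U y. open_subgroup X G U \<and> (\<forall>g\<in>U. tensor_action X G Y \<psi> g v = v) \<and>
          (\<forall>a. stable_under U \<psi> (P a)) \<and>
          (\<forall>C \<in> orbits (perm_group X U) (P i) \<psi>. y C \<in> C) \<and>
          c = (\<Sum>C \<in> orbits (perm_group X U) (P i) \<psi>.
                 ghat_value X G \<mu> U C (restrict_action \<psi> C) * v (move i j (y C) P)))"

definition E_op ::
  "'x set \<Rightarrow> ('x \<Rightarrow> 'x) set \<Rightarrow> ('x, 'k::field) ghat_function \<Rightarrow> 'y set \<Rightarrow> (('x \<Rightarrow> 'x) \<Rightarrow> 'y \<Rightarrow> 'y) \<Rightarrow>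
   'r::finite \<Rightarrow> 'r \<Rightarrow> (('r \<Rightarrow> 'y set) \<Rightarrow> 'k) \<Rightarrow> ('r \<Rightarrow> 'y set) \<Rightarrow> 'k" where
  "E_op X G \<mu> Y \<psi> i j v =
     (\<lambda>P. if P \<in> Part X G Y \<psi> then THE c. E_value X G \<mu> Y \<psi> i j v P c else 0)"


section \<open>Actions of \<open>\<gg>\<ll>\<^sub>r\<close>\<close>

definition fun_scale :: "'k::times \<Rightarrow> ('w \<Rightarrow> 'k) \<Rightarrow> 'w \<Rightarrow> 'k" where
  "fun_scale c v = (\<lambda>w. c * v w)"

definition mat_scale :: "'k::times \<Rightarrow> 'k^'n^'m \<Rightarrow> 'k^'n^'m" where
  "mat_scale c A = (\<chi> a b. c * A $ a $ b)"

definition elementary_matrix :: "'r \<Rightarrow> 'r \<Rightarrow> 'k::zero_neq_one^'r^'r" where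
  "elementary_matrix i j = (\<chi> a b. if a = i \<and> b = j then 1 else 0)"

definition gl_bracket :: "'k::field^'r^'r \<Rightarrow> 'k^'r^'r \<Rightarrow> 'k^'r^'r" where
  "gl_bracket A B = A ** B - B ** A"

text \<open>
  \<open>\<rho>\<close> is an action of the Lie algebra of all \<open>r \<times> r\<close> matrices on the linear subspace \<open>V\<close> of a space
  of \<open>k\<close>-valued functions; \<open>\<rho> A\<close> is only relevant on \<open>V\<close>.
\<close>

definition gl_action ::
  "('w \<Rightarrow> 'k::field) set \<Rightarrow> ('k^'r^'r \<Rightarrow> ('w \<Rightarrow> 'k) \<Rightarrow> ('w \<Rightarrow> 'k)) \<Rightarrow> bool" where
  "gl_action V \<rho> \<longleftrightarrow>
     module.subspace fun_scale V \<and>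
     (\<forall>A. \<forall>v\<in>V. \<rho> A v \<in> V) \<and>
     (\<forall>A. \<forall>v\<in>V. \<forall>w\<in>V. \<rho> A (v + w) = \<rho> A v + \<rho> A w) \<and>
     (\<forall>A c. \<forall>v\<in>V. \<rho> A (fun_scale c v) = fun_scale c (\<rho> A v)) \<and>
     (\<forall>A B. \<forall>v\<in>V. \<rho> (A + B) v = \<rho> A v + \<rho> B v) \<and>
     (\<forall>A c. \<forall>v\<in>V. \<rho> (mat_scale c A) v = fun_scale c (\<rho> A v)) \<and>
     (\<forall>A B. \<forall>v\<in>V. \<rho> (gl_bracket A B) v = \<rho> A (\<rho> B v) - \<rho> B (\<rho> A v))"

lemma module_fun_scale: "module (fun_scale :: 'k::field \<Rightarrow> ('w \<Rightarrow> 'k) \<Rightarrow> 'w \<Rightarrow> 'k)"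
  by standard (auto simp: fun_scale_def fun_eq_iff algebra_simps)

end

theory Submission
imports Defs
begin

text \<open>
  The measure on the G-hat-subsets of \<open>Y\<close> is finitely additive, so functions on \<open>Y\<close> that are invariant
  under an open subgroup can be integrated, and \<open>(E\<^sub>i\<^sub>j v)(P)\<close> is the integral over \<open>y \<in> P\<^sub>i\<close> of
  \<open>v(P\<^sub>y)\<close>, also for \<open>i = j\<close>. Independence of choices, linearity and equivariance are then properties
  of the integral. In \<open>E\<^sub>i\<^sub>j E\<^sub>k\<^sub>l v\<close> a point \<open>y\<close> is moved from \<open>P\<^sub>i\<close> to \<open>P\<^sub>j\<close> and then a point \<open>z\<close> from the
  \<open>k\<close>-th to the \<open>l\<close>-th part. The pairs \<open>y \<noteq> z\<close> contribute the same double integral to \<open>E\<^sub>k\<^sub>l E\<^sub>i\<^sub>j v\<close> by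
  Fubini's theorem, while \<open>z = y\<close> is possible only if \<open>k = j\<close> and contributes \<open>E\<^sub>i\<^sub>l v\<close>. Fubini's theorem
  reduces to indicator functions of single orbits of an open subgroup on \<open>Y \<times> Y\<close>, and there it is the
  fibration axiom of the measure for the two projections.
\<close>

section \<open>Open subgroups\<close>

text \<open>In \<open>E i j (E k l v)\<close> the inner operator is evaluated at a tuple that
  depends on the moved point \<open>y\<close>, and so does the stabilizer of that tuple. The
  integral must therefore be free of groups: \<open>vol\<close> hides the choice of a group and of
  codes, and \<open>integ\<close> sums over the values of a function instead of over orbits. Orbit
  sums return through \<open>integ_orbits\<close> wherever one group suffices. Oligomorphy enters
  through finiteness: a smooth set with finitely many \<open>G\<close>-orbits has finitely many
  orbits under every open subgroup, and then its square has finitely many \<open>G\<close>-orbits,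
  so the same measure integrates over the square. The fibration axiom is applied to the first
  projection; the other order of integration comes from the coordinate swap, an equivariant
  bijection of the square. The conjugation axiom makes the integral invariant under translation by
  \<open>G\<close>, which gives both the equivariance of the operators and the smoothness of an
  inner integral in the outer variable. Coinciding pairs count with weight 1 because a point has
  volume 1.\<close>

lemma perm_group_simps [simp]:
  "carrier (perm_group X U) = U"
  "mult (perm_group X U) = mult (BijGroup X)"
  "one (perm_group X U) = one (BijGroup X)"
  by (simp_all add: perm_group_def)

lemma stable_underD: "stable_under U \<alpha> S \<Longrightarrow> g \<in> U \<Longrightarrow> w \<in> S \<Longrightarrow> \<alpha> g w \<in> S"
  unfolding stable_under_def by blast

lemma stable_under_mono: "stable_under U \<alpha> S \<Longrightarrow> V \<subseteq> U \<Longrightarrow> stable_under V \<alpha> S"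
  unfolding stable_under_def by blast

locale oligomorphic_group =
  fixes X :: "'x set" and G :: "('x \<Rightarrow> 'x) set"
  assumes oligomorphic: "oligomorphic X G"
begin

abbreviation mul (infixl "\<odot>" 70) where "g \<odot> h \<equiv> g \<otimes>\<^bsub>BijGroup X\<^esub> h"
abbreviation inverse_perm ("iv") where "iv g \<equiv> inv\<^bsub>BijGroup X\<^esub> g"
abbreviation "opn \<equiv> open_subgroup X G"

sublocale B: group "BijGroup X" by (rule group_BijGroup)

lemma subgroup_G: "subgroup G (BijGroup X)"
  using oligomorphic by (simp add: oligomorphic_def)

lemma G_carrier: "g \<in> G \<Longrightarrow> g \<in> carrier (BijGroup X)"
  using subgroup.mem_carrier[OF subgroup_G] .

lemma opn_subgroup: "opn U \<Longrightarrow> subgroup U (BijGroup X)"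
  unfolding open_subgroup_def perm_group_def by (metis B.incl_subgroup subgroup_G)

lemma opn_subset: "opn U \<Longrightarrow> U \<subseteq> G"
  unfolding open_subgroup_def perm_group_def using subgroup.subset by fastforce

lemma opn_in_G: "opn U \<Longrightarrow> g \<in> U \<Longrightarrow> g \<in> G"
  using opn_subset by blast

lemma opnI:
  assumes "subgroup U (BijGroup X)" "U \<subseteq> G" "finite A" "A \<subseteq> X" "{g \<in> G. \<forall>x\<in>A. g x = x} \<subseteq> U"
  shows "opn U"
  unfolding open_subgroup_iff[OF subgroup_G] using assms
  by (auto simp: perm_group_def intro!: B.subgroup_incl subgroup_G)

lemma opnE:
  assumes "opn U"
  obtains A where "finite A" "A \<subseteq> X" "{g \<in> G. \<forall>x\<in>A. g x = x} \<subseteq> U"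
  using assms unfolding open_subgroup_iff[OF subgroup_G] by blast

lemma opn_G: "opn G"
  by (rule opnI[of _ "{}"]) (auto simp: subgroup_G)

lemma opn_Int: "opn U \<Longrightarrow> opn V \<Longrightarrow> opn (U \<inter> V)"
proof -
  assume U: "opn U" and V: "opn V"
  obtain A where A: "finite A" "A \<subseteq> X" "{g \<in> G. \<forall>x\<in>A. g x = x} \<subseteq> U" by (rule opnE[OF U])
  obtain C where C: "finite C" "C \<subseteq> X" "{g \<in> G. \<forall>x\<in>C. g x = x} \<subseteq> V" by (rule opnE[OF V])
  show ?thesis
    by (rule opnI[of _ "A \<union> C"])
      (use A C opn_subset[OF U] opn_subgroup[OF U] opn_subgroup[OF V] in
        \<open>auto intro: B.subgroups_Inter_pair\<close>)
qed

lemma opn_mult: "opn U \<Longrightarrow> g \<in> U \<Longrightarrow> h \<in> U \<Longrightarrow> g \<odot> h \<in> U"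
  using opn_subgroup subgroup.m_closed by metis

lemma opn_inv: "opn U \<Longrightarrow> g \<in> U \<Longrightarrow> iv g \<in> U"
  using opn_subgroup subgroup.m_inv_closed by metis

lemma opn_one: "opn U \<Longrightarrow> \<one>\<^bsub>BijGroup X\<^esub> \<in> U"
  using opn_subgroup subgroup.one_closed by metis

lemmas G_mult = opn_mult[OF opn_G] and G_inv = opn_inv[OF opn_G] and G_one = opn_one[OF opn_G]

lemma mult_apply: "g \<in> G \<Longrightarrow> h \<in> G \<Longrightarrow> x \<in> X \<Longrightarrow> (g \<odot> h) x = g (h x)"
  using G_carrier by (auto simp: BijGroup_def compose_def)

lemma inv_apply: "g \<in> G \<Longrightarrow> x \<in> X \<Longrightarrow> iv g (g x) = x"
  using mult_apply[of "iv g" g x] G_inv[of g] G_carrier[of g] B.l_inv[of g]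
  by (simp add: BijGroup_def)

lemma G_funcset: "g \<in> G \<Longrightarrow> x \<in> X \<Longrightarrow> g x \<in> X"
  using G_carrier[of g] Bij_imp_funcset[of g X] by (auto simp: BijGroup_def)

lemma conj_subgroup_iff:
  assumes "g \<in> G" "opn U" "h \<in> G"
  shows "h \<in> conj_subgroup X g U \<longleftrightarrow> iv g \<odot> h \<odot> g \<in> U"
proof
  assume "h \<in> conj_subgroup X g U"
  then obtain u where u: "u \<in> U" "h = g \<odot> u \<odot> iv g" by (auto simp: conj_subgroup_def)
  have c: "g \<in> carrier (BijGroup X)" "u \<in> carrier (BijGroup X)"
    using assms u opn_in_G G_carrier by auto
  have "iv g \<odot> h \<odot> g = u" unfolding u(2) using c
    by (simp add: B.m_assoc) (simp add: B.m_assoc[symmetric])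
  then show "iv g \<odot> h \<odot> g \<in> U" using u by simp
next
  assume u: "iv g \<odot> h \<odot> g \<in> U"
  have c: "g \<in> carrier (BijGroup X)" "h \<in> carrier (BijGroup X)"
    using assms G_carrier by auto
  have "h = g \<odot> (iv g \<odot> h \<odot> g) \<odot> iv g" using c
    by (simp add: B.m_assoc) (simp add: B.m_assoc[symmetric])
  then show "h \<in> conj_subgroup X g U" using u unfolding conj_subgroup_def by (rule image_eqI)
qed

lemma conj_subgroup_subset: "g \<in> G \<Longrightarrow> opn U \<Longrightarrow> conj_subgroup X g U \<subseteq> G"
  unfolding conj_subgroup_def using opn_in_G G_mult G_inv by blast

text \<open>If \<open>A\<close> supports \<open>U\<close>, then the translate of \<open>A\<close> by
  \<open>g\<close> supports the conjugate: an \<open>h\<close> that fixes the translate pointwise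
  gives \<open>iv g \<odot> h \<odot> g\<close> fixing \<open>A\<close> pointwise.\<close>

lemma opn_conj:
  assumes g: "g \<in> G" and U: "opn U"
  shows "opn (conj_subgroup X g U)"
proof -
  obtain A where A: "finite A" "A \<subseteq> X" "{g \<in> G. \<forall>x\<in>A. g x = x} \<subseteq> U" by (rule opnE[OF U])
  have c: "g \<in> carrier (BijGroup X)" using g G_carrier by auto
  have Uc: "\<And>u. u \<in> U \<Longrightarrow> u \<in> carrier (BijGroup X)" using U opn_in_G G_carrier by auto
  show ?thesis
  proof (rule opnI[of _ "g ` A"])
    show "subgroup (conj_subgroup X g U) (BijGroup X)"
    proof
      show "conj_subgroup X g U \<subseteq> carrier (BijGroup X)"
        using conj_subgroup_subset[OF g U] G_carrier by blast
      show "\<one>\<^bsub>BijGroup X\<^esub> \<in> conj_subgroup X g U"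
        using c opn_one[OF U] by (subst conj_subgroup_iff[OF g U G_one]) simp
    next
      fix a b assume ab: "a \<in> conj_subgroup X g U" "b \<in> conj_subgroup X g U"
      then have abG: "a \<in> G" "b \<in> G" using conj_subgroup_subset[OF g U] by auto
      have "(iv g \<odot> a \<odot> g) \<odot> (iv g \<odot> b \<odot> g) \<in> U"
        using ab abG conj_subgroup_iff[OF g U]
        by (intro opn_mult[OF U, of "iv g \<odot> a \<odot> g" "iv g \<odot> b \<odot> g"]) auto
      also have "(iv g \<odot> a \<odot> g) \<odot> (iv g \<odot> b \<odot> g) = iv g \<odot> (a \<odot> b) \<odot> g"
        using c abG[THEN G_carrier]
        by (simp add: B.m_assoc) (simp add: B.m_assoc[symmetric])
      finally show "a \<odot> b \<in> conj_subgroup X g U"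
        using conj_subgroup_iff[OF g U] abG G_mult by auto
    next
      fix a assume a: "a \<in> conj_subgroup X g U"
      then have aG: "a \<in> G" using conj_subgroup_subset[OF g U] by auto
      have "iv (iv g \<odot> a \<odot> g) \<in> U"
        using a aG conj_subgroup_iff[OF g U] by (intro opn_inv[OF U]) auto
      also have "iv (iv g \<odot> a \<odot> g) = iv g \<odot> iv a \<odot> g"
        using c aG[THEN G_carrier] by (simp add: B.inv_mult_group B.m_assoc)
      finally show "iv a \<in> conj_subgroup X g U"
        using conj_subgroup_iff[OF g U] aG G_inv by auto
    qed
    show "{h \<in> G. \<forall>x\<in>g ` A. h x = x} \<subseteq> conj_subgroup X g U"
    proof
      fix h assume "h \<in> {h \<in> G. \<forall>x\<in>g ` A. h x = x}"
      then have h: "h \<in> G" "\<And>x. x \<in> A \<Longrightarrow> h (g x) = g x" by auto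
      have "(iv g \<odot> h \<odot> g) x = x" if "x \<in> A" for x
        using that A(2) h g by (simp add: mult_apply inv_apply G_inv G_mult G_funcset subset_iff)
      then have "iv g \<odot> h \<odot> g \<in> U" using A(3) g h G_inv G_mult by auto
      then show "h \<in> conj_subgroup X g U" using conj_subgroup_iff[OF g U h(1)] by simp
    qed
  qed (use A g G_funcset conj_subgroup_subset[OF g U] in auto)
qed

end

section \<open>G-hat-sets and orbit finiteness\<close>

lemma orbit_perm_group: "orbit (perm_group X U) \<alpha> w = (\<lambda>g. \<alpha> g w) ` U"
  by (auto simp: orbit_def)

lemma orbits_perm_group: "orbits (perm_group X U) Z \<alpha> = (\<lambda>w. (\<lambda>g. \<alpha> g w) ` U) ` Z"
  by (auto simp: orbits_def orbit_perm_group)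

lemma stabilizer_perm_group: "stabilizer (perm_group X U) \<alpha> w = {g \<in> U. \<alpha> g w = w}"
  by (simp add: stabilizer_def)

lemma orbits_restrict_action:
  "S \<subseteq> T \<Longrightarrow> orbits (perm_group X U) S (restrict_action \<alpha> T) = orbits (perm_group X U) S \<alpha>"
  unfolding orbits_perm_group restrict_action_def by (intro image_cong) auto

text \<open>On \<open>A\<close> the map \<open>h\<close> factors through \<open>f\<close>. This
  bounds a set of orbits by a finite set of invariants that determine them.\<close>

lemma finite_image_factor:
  assumes fin: "finite (f ` A)"
    and factor: "\<And>x y. x \<in> A \<Longrightarrow> y \<in> A \<Longrightarrow> f x = f y \<Longrightarrow> h x = h y"
  shows "finite (h ` A)"
proof -
  have "h x = h (inv_into A f (f x))" if "x \<in> A" for x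
    using that by (intro factor) (auto simp: inv_into_into f_inv_into_f)
  then have "h ` A \<subseteq> (\<lambda>c. h (inv_into A f c)) ` f ` A" by (auto simp: image_iff)
  then show ?thesis by (rule finite_subset) (intro finite_imageI fin)
qed

context oligomorphic_group
begin

text \<open>The pointwise laws suffice: they make \<open>\<alpha> (iv g)\<close> a two-sided inverse
  of \<open>\<alpha> g\<close>, which gives bijectivity, and extensionality turns pointwise
  multiplicativity into an equation in \<open>BijGroup Z\<close>.\<close>

lemma ghat_setI:
  assumes U: "opn U"
    and ext: "\<And>g. g \<in> U \<Longrightarrow> \<alpha> g \<in> extensional Z"
    and cl: "\<And>g z. g \<in> U \<Longrightarrow> z \<in> Z \<Longrightarrow> \<alpha> g z \<in> Z"
    and one: "\<And>z. z \<in> Z \<Longrightarrow> \<alpha> \<one>\<^bsub>BijGroup X\<^esub> z = z"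
    and mult: "\<And>g h z. g \<in> U \<Longrightarrow> h \<in> U \<Longrightarrow> z \<in> Z \<Longrightarrow> \<alpha> (g \<odot> h) z = \<alpha> g (\<alpha> h z)"
    and stab: "\<And>z. z \<in> Z \<Longrightarrow> opn {g \<in> U. \<alpha> g z = z}"
    and fin: "finite (orbits (perm_group X U) Z \<alpha>)"
  shows "ghat_set X G U Z \<alpha>"
proof -
  have inv: "\<alpha> (iv g) (\<alpha> g z) = z" "\<alpha> g (\<alpha> (iv g) z) = z" if "g \<in> U" "z \<in> Z" for g z
    using that mult[of "iv g" g z] mult[of g "iv g" z] one opn_inv[OF U] opn_in_G[OF U] G_carrier
    by auto
  have Bij: "\<alpha> g \<in> Bij Z" if "g \<in> U" for g
    unfolding Bij_def using ext that cl inv opn_inv[OF U]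
    by (auto intro!: bij_betw_byWitness[where f' = "\<alpha> (iv g)"])
  have "\<alpha> (g \<odot> h) = compose Z (\<alpha> g) (\<alpha> h)" if "g \<in> U" "h \<in> U" for g h
    using that ext opn_mult[OF U] mult
    by (intro extensionalityI[of _ Z]) (auto simp: compose_def)
  moreover have "group (perm_group X U)"
    unfolding perm_group_def by (rule B.subgroup_imp_group[OF opn_subgroup[OF U]])
  ultimately have "group_action (perm_group X U) Z \<alpha>"
    unfolding group_action_def group_hom_def group_hom_axioms_def hom_def
    using Bij by (auto simp: group_BijGroup) (auto simp: BijGroup_def)
  then show ?thesis
    unfolding ghat_set_def stabilizer_perm_group using U stab fin by auto
qed

lemma
  assumes Z: "ghat_set X G U Z \<alpha>"
  shows ghat_set_closed: "g \<in> U \<Longrightarrow> z \<in> Z \<Longrightarrow> \<alpha> g z \<in> Z"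
    and ghat_set_extensional: "g \<in> U \<Longrightarrow> \<alpha> g \<in> extensional Z"
    and ghat_set_one: "z \<in> Z \<Longrightarrow> \<alpha> \<one>\<^bsub>BijGroup X\<^esub> z = z"
    and ghat_set_mult: "g \<in> U \<Longrightarrow> h \<in> U \<Longrightarrow> z \<in> Z \<Longrightarrow> \<alpha> (g \<odot> h) z = \<alpha> g (\<alpha> h z)"
proof -
  interpret A: group_action "perm_group X U" Z \<alpha> using Z by (simp add: ghat_set_def)
  show "g \<in> U \<Longrightarrow> z \<in> Z \<Longrightarrow> \<alpha> g z \<in> Z" by (rule A.element_image) simp_all
  show "g \<in> U \<Longrightarrow> \<alpha> g \<in> extensional Z" using A.bij_prop0[of g] by (simp add: Bij_def)
  show "z \<in> Z \<Longrightarrow> \<alpha> \<one>\<^bsub>BijGroup X\<^esub> z = z" using fun_cong[OF A.id_eq_one, of z] by simp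
  show "g \<in> U \<Longrightarrow> h \<in> U \<Longrightarrow> z \<in> Z \<Longrightarrow> \<alpha> (g \<odot> h) z = \<alpha> g (\<alpha> h z)"
    using A.composition_rule[of z g h] by simp
qed

lemma ghat_set_opn: "ghat_set X G U Z \<alpha> \<Longrightarrow> opn U"
  unfolding ghat_set_def by simp

lemma ghat_set_stab: "ghat_set X G U Z \<alpha> \<Longrightarrow> z \<in> Z \<Longrightarrow> opn {g \<in> U. \<alpha> g z = z}"
  unfolding ghat_set_def stabilizer_perm_group by simp

lemma ghat_set_finite_orbits: "ghat_set X G U Z \<alpha> \<Longrightarrow> finite (orbits (perm_group X U) Z \<alpha>)"
  unfolding ghat_set_def by simp

text \<open>In contrast to \<open>ghat_set_transport\<close>, the action \<open>\<beta>\<close> on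
  the image is given and only has to agree with the transported one on \<open>U\<close>. This covers
  restrictions of \<open>code_action\<close> and conjugated actions.\<close>

lemma ghat_set_image:
  assumes Z: "ghat_set X G U Z \<alpha>" and e: "inj_on e Z"
    and ext: "\<And>g. g \<in> U \<Longrightarrow> \<beta> g \<in> extensional (e ` Z)"
    and eq: "\<And>g z. g \<in> U \<Longrightarrow> z \<in> Z \<Longrightarrow> \<beta> g (e z) = e (\<alpha> g z)"
  shows "ghat_set X G U (e ` Z) \<beta>" "ghat_iso X G U Z \<alpha> U (e ` Z) \<beta>"
proof -
  note U = ghat_set_opn[OF Z]
  note cl = ghat_set_closed[OF Z]
  show "ghat_set X G U (e ` Z) \<beta>"
  proof (rule ghat_setI)
    fix w assume "w \<in> e ` Z"
    then obtain z where z: "z \<in> Z" "w = e z" by blast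
    then have "{g \<in> U. \<beta> g w = w} = {g \<in> U. \<alpha> g z = z}"
      using eq cl inj_onD[OF e] by auto
    then show "opn {g \<in> U. \<beta> g w = w}" using ghat_set_stab[OF Z z(1)] by simp
  next
    have "orbits (perm_group X U) (e ` Z) \<beta> = (\<lambda>C. e ` C) ` orbits (perm_group X U) Z \<alpha>"
      unfolding orbits_perm_group image_image by (intro image_cong refl) (simp add: eq)
    then show "finite (orbits (perm_group X U) (e ` Z) \<beta>)"
      using ghat_set_finite_orbits[OF Z] by simp
  qed (use U ext eq cl ghat_set_one[OF Z] ghat_set_mult[OF Z] opn_one[OF U] opn_mult[OF U] in auto)
  show "ghat_iso X G U Z \<alpha> U (e ` Z) \<beta>"
    unfolding ghat_iso_def
    by (intro exI[of _ U] exI[of _ e]) (use e U eq in \<open>auto simp: inj_on_imp_bij_betw\<close>)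
qed

end

section \<open>Smooth orbit-finite sets remain orbit-finite under open subgroups\<close>

locale smooth_set = oligomorphic_group X G
  for X :: "'x set" and G :: "('x \<Rightarrow> 'x) set" +
  fixes W :: "'w set" and \<alpha> :: "('x \<Rightarrow> 'x) \<Rightarrow> 'w \<Rightarrow> 'w"
  assumes ghat_set_W: "ghat_set X G G W \<alpha>"
begin

lemmas act_closed = ghat_set_closed[OF ghat_set_W]
  and act_one = ghat_set_one[OF ghat_set_W]
  and act_mult = ghat_set_mult[OF ghat_set_W]
  and opn_stab = ghat_set_stab[OF ghat_set_W]

lemma act_inv: "g \<in> G \<Longrightarrow> w \<in> W \<Longrightarrow> \<alpha> (iv g) (\<alpha> g w) = w"
  and act_inv': "g \<in> G \<Longrightarrow> w \<in> W \<Longrightarrow> \<alpha> g (\<alpha> (iv g) w) = w"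
  using act_mult[of "iv g" g w] act_mult[of g "iv g" w] G_inv act_one G_carrier by auto

lemma act_inj: "g \<in> G \<Longrightarrow> inj_on (\<alpha> g) W"
  by (metis act_inv inj_onI)

lemma act_image: "g \<in> G \<Longrightarrow> \<alpha> g ` W = W"
  using act_closed act_inv' G_inv by (auto simp: image_iff) metis

text \<open>
  If \<open>A\<close> and \<open>B\<close> are the supports of \<open>w\<close> and of \<open>U\<close>, the \<open>U\<close>-orbit of \<open>g w\<close> is determined by the
  \<open>G\<close>-orbit of the tuple \<open>(B, g A)\<close>.
\<close>

lemma finite_orbits_on_orbit:
  assumes U: "opn U" and w: "w \<in> W"
  shows "finite ((\<lambda>g. (\<lambda>u. \<alpha> u (\<alpha> g w)) ` U) ` G)"
proof -
  obtain A where A: "finite A" "A \<subseteq> X" "{g \<in> G. \<forall>x\<in>A. g x = x} \<subseteq> {g \<in> G. \<alpha> g w = w}"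
    by (rule opnE[OF opn_stab[OF w]])
  obtain B where B: "finite B" "B \<subseteq> X" "{g \<in> G. \<forall>x\<in>B. g x = x} \<subseteq> U" by (rule opnE[OF U])
  obtain as where as: "set as = A" using A finite_list by blast
  obtain bs where bs: "set bs = B" using B finite_list by blast
  let ?n = "length bs + length as"
  let ?L = "{xs. length xs = ?n \<and> set xs \<subseteq> X}"
  let ?t = "\<lambda>g. bs @ map g as"
  let ?f = "\<lambda>g. orbit (perm_group X G) map (?t g)"
  let ?h = "\<lambda>g. (\<lambda>u. \<alpha> u (\<alpha> g w)) ` U"
  have "finite (orbits (perm_group X G) ?L map)"
    using oligomorphic by (simp add: oligomorphic_def)
  moreover have "?t g \<in> ?L" if "g \<in> G" for g
    using as bs A(2) B(2) G_funcset[OF that] by auto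
  then have "?f ` G \<subseteq> orbits (perm_group X G) ?L map"
    unfolding orbits_def by blast
  ultimately have fin: "finite (?f ` G)" by (rule rev_finite_subset)
  have key: "?h g \<subseteq> ?h k" if g: "g \<in> G" and k: "k \<in> G" and eq: "?f g = ?f k" for g k
  proof -
    have "?t g = map \<one>\<^bsub>BijGroup X\<^esub> (?t g)"
      using as bs A B G_funcset[OF g]
      by (auto simp: BijGroup_def intro!: map_idI[symmetric])
    then have "?t g \<in> ?f g" unfolding orbit_perm_group using G_one by (rule image_eqI)
    then have "?t g \<in> ?f k" using eq by simp
    then obtain h where h: "h \<in> G" "?t g = map h (?t k)" unfolding orbit_perm_group by blast
    have hb: "h b = b" if "b \<in> B" for b
    proof -
      have "map h bs = map (\<lambda>x. x) bs" using h(2) by simp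
      then show ?thesis using that bs by (metis map_eq_conv)
    qed
    have ha: "g a = h (k a)" if "a \<in> A" for a
      using h(2) that as by simp
    have hU: "h \<in> U" using B(3) h hb by auto
    \<comment> \<open>Here \<open>h\<close> lies in \<open>U\<close>, and this element fixes the
      support \<open>A\<close> of \<open>w\<close>, hence \<open>w\<close> itself; so
      \<open>\<alpha> g w\<close> and \<open>\<alpha> k w\<close> differ by \<open>h\<close> and
      have the same \<open>U\<close>-orbit.\<close>
    have "(iv k \<odot> (iv h \<odot> g)) a = a" if a: "a \<in> A" for a
    proof -
      have aX: "a \<in> X" using a A(2) by blast
      have "(iv k \<odot> (iv h \<odot> g)) a = iv k (iv h (g a))"
        using aX g h(1) k by (simp add: mult_apply G_inv G_mult)
      also have "\<dots> = a"
        using ha[OF a] inv_apply[OF h(1) G_funcset[OF k aX]] inv_apply[OF k aX] by simp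
      finally show ?thesis .
    qed
    moreover have "iv k \<odot> (iv h \<odot> g) \<in> G" using g h(1) k G_inv G_mult by simp
    ultimately have "iv k \<odot> (iv h \<odot> g) \<in> {g \<in> G. \<alpha> g w = w}"
      by (intro subsetD[OF A(3)]) simp
    then have "\<alpha> (iv k \<odot> (iv h \<odot> g)) w = w" by simp
    then have "\<alpha> (iv k) (\<alpha> (iv h) (\<alpha> g w)) = w"
      using g h(1) k w by (simp add: act_mult act_closed G_inv G_mult)
    then have "\<alpha> k w = \<alpha> (iv h) (\<alpha> g w)"
      using act_inv'[OF k, of "\<alpha> (iv h) (\<alpha> g w)"] act_closed g w G_inv[OF h(1)] by simp
    then have "\<alpha> g w = \<alpha> h (\<alpha> k w)"
      using act_inv'[OF h(1), of "\<alpha> g w"] act_closed g w by simp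
    then have "\<alpha> u (\<alpha> g w) = \<alpha> (u \<odot> h) (\<alpha> k w)" if "u \<in> U" for u
      using act_mult[OF opn_in_G[OF U that] h(1) act_closed[OF k w]] by simp
    then show ?thesis using opn_mult[OF U _ hU] by auto
  qed
  have "?h g = ?h k" if "g \<in> G" "k \<in> G" "?f g = ?f k" for g k
    using key[OF that] key[OF that(2,1) that(3)[symmetric]] by (rule equalityI)
  with fin show ?thesis by (rule finite_image_factor)
qed

text \<open>Each \<open>U\<close>-orbit lies in one of finitely many \<open>G\<close>-orbits; a base
  point chosen in each of these reduces the claim to the preceding lemma.\<close>

lemma finite_orbits:
  assumes U: "opn U"
  shows "finite (orbits (perm_group X U) W \<alpha>)"
proof -
  let ?O = "orbits (perm_group X G) W \<alpha>"
  let ?h = "\<lambda>w. (\<lambda>g. (\<lambda>u. \<alpha> u (\<alpha> g w)) ` U) ` G"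
  have rep: "\<exists>w\<in>W. C = (\<lambda>g. \<alpha> g w) ` G \<and> w \<in> C" if C: "C \<in> ?O" for C
  proof -
    obtain w where w: "w \<in> W" "C = (\<lambda>g. \<alpha> g w) ` G" using C unfolding orbits_perm_group by blast
    then have "w \<in> C" using act_one[OF w(1)] G_one by (metis image_eqI)
    then show ?thesis using w by blast
  qed
  have some: "(SOME w. w \<in> C) \<in> C" if C: "C \<in> ?O" for C
    using rep[OF C] by (auto intro: someI)
  have some_W: "(SOME w. w \<in> C) \<in> W" if C: "C \<in> ?O" for C
    using rep[OF C] some[OF C] act_closed by auto
  have "orbits (perm_group X U) W \<alpha> \<subseteq> (\<Union>C\<in>?O. ?h (SOME w. w \<in> C))"
  proof
    fix D assume "D \<in> orbits (perm_group X U) W \<alpha>"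
    then obtain w where w: "w \<in> W" "D = (\<lambda>u. \<alpha> u w) ` U" unfolding orbits_perm_group by blast
    let ?C = "(\<lambda>g. \<alpha> g w) ` G"
    have C: "?C \<in> ?O" using w(1) unfolding orbits_perm_group by (rule imageI)
    obtain g where g: "g \<in> G" "(SOME w. w \<in> ?C) = \<alpha> g w" using some[OF C] by blast
    have "D = (\<lambda>u. \<alpha> u (\<alpha> (iv g) (SOME w. w \<in> ?C))) ` U"
      using w g by (simp only: act_inv)
    then have "D \<in> ?h (SOME w. w \<in> ?C)" using G_inv[OF g(1)] by (rule image_eqI)
    with C show "D \<in> (\<Union>C\<in>?O. ?h (SOME w. w \<in> C))" by (rule UN_I)
  qed
  moreover have "finite (\<Union>C\<in>?O. ?h (SOME w. w \<in> C))"
    by (rule finite_UN_I[OF ghat_set_finite_orbits[OF ghat_set_W]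
          finite_orbits_on_orbit[OF U some_W]])
  ultimately show ?thesis by (rule finite_subset)
qed

lemma finite_orbits_subset: "opn U \<Longrightarrow> S \<subseteq> W \<Longrightarrow> finite (orbits (perm_group X U) S \<alpha>)"
  by (rule finite_subset[OF _ finite_orbits]) (simp_all add: orbits_perm_group image_mono)

lemma ghat_set_restrict:
  assumes U: "opn U" and S: "S \<subseteq> W" "stable_under U \<alpha> S"
  shows "ghat_set X G U S (restrict_action \<alpha> S)"
proof (rule ghat_setI[OF U])
  note SW = subsetD[OF S(1)] and UG = opn_in_G[OF U] and cl = stable_underD[OF S(2)]
  have app: "restrict_action \<alpha> S g w = \<alpha> g w" if "w \<in> S" for g w
    using that by (simp add: restrict_action_def)
  show "finite (orbits (perm_group X U) S (restrict_action \<alpha> S))"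
    using finite_orbits_subset[OF U S(1)] by (simp add: orbits_restrict_action)
  show "restrict_action \<alpha> S g \<in> extensional S" for g
    by (simp add: restrict_action_def)
  fix w assume w: "w \<in> S"
  show "restrict_action \<alpha> S \<one>\<^bsub>BijGroup X\<^esub> w = w"
    using w SW by (simp add: app act_one)
  have "{g \<in> U. restrict_action \<alpha> S g w = w} = U \<inter> {g \<in> G. \<alpha> g w = w}"
    using w UG by (auto simp: app)
  then show "opn {g \<in> U. restrict_action \<alpha> S g w = w}"
    using opn_Int[OF U opn_stab[OF SW[OF w]]] by simp
  fix g assume g: "g \<in> U"
  show "restrict_action \<alpha> S g w \<in> S"
    using w g cl by (simp add: app)
  fix h assume h: "h \<in> U"
  show "restrict_action \<alpha> S (g \<odot> h) w = restrict_action \<alpha> S g (restrict_action \<alpha> S h w)"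
    using w cl[OF h w] act_mult[OF UG[OF g] UG[OF h] SW[OF w]] by (simp add: app)
qed

end

section \<open>The measure of G-hat-subsets\<close>

lemma restrict_action_restrict_action:
  "S \<subseteq> T \<Longrightarrow> restrict_action (restrict_action \<alpha> T) S = restrict_action \<alpha> S"
  by (auto simp: restrict_action_def fun_eq_iff)

locale measured_group = oligomorphic_group X G + ghat_measure X G \<mu>
  for X :: "'x set" and G :: "('x \<Rightarrow> 'x) set" and \<mu> :: "('x, 'k::field) ghat_function"
begin

lemma ghat_value_image:
  fixes e :: "'z \<Rightarrow> 'x ghat_point"
  assumes "ghat_set X G U Z \<alpha>" "inj_on e Z" "\<And>g. g \<in> U \<Longrightarrow> \<beta> g \<in> extensional (e ` Z)"
    and "\<And>g z. g \<in> U \<Longrightarrow> z \<in> Z \<Longrightarrow> \<beta> g (e z) = e (\<alpha> g z)"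
  shows "ghat_value X G \<mu> U Z \<alpha> = \<mu> U (e ` Z) \<beta>"
  by (rule ghat_value_eq[OF subgroup_G assms(1) ghat_set_image[where \<beta> = \<beta>, OF assms]])

end

locale measured_set = measured_group X G \<mu> + smooth_set X G W \<alpha>
  for X :: "'x set" and G :: "('x \<Rightarrow> 'x) set" and \<mu> :: "('x, 'k::field) ghat_function"
    and W :: "'w set" and \<alpha> :: "('x \<Rightarrow> 'x) \<Rightarrow> 'w \<Rightarrow> 'w"
begin

text \<open>A measure is only defined on sets of codes, so \<open>W\<close> is embedded into that type once and for all.\<close>

definition code :: "'w \<Rightarrow> 'x ghat_point" where
  "code = (SOME e. inj_on e W)"

text \<open>With the inverse of \<open>code\<close> taken on all of \<open>W\<close>, the actions on
  the codes of all subsets are restrictions of one map. Restricting from a union to a summand, or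
  from an orbit to a fiber, then yields literally the action in which \<open>vol\<close> is
  expressed.\<close>

definition code_action :: "('x \<Rightarrow> 'x) \<Rightarrow> 'x ghat_point \<Rightarrow> 'x ghat_point" where
  "code_action g p = code (\<alpha> g (inv_into W code p))"

lemma inj_code: "inj_on code W"
proof -
  obtain Z' :: "'x ghat_point set" and \<alpha>' where "ghat_iso X G G W \<alpha> G Z' \<alpha>'"
    using ghat_set_has_copy[OF ghat_set_W] by blast
  then have "\<exists>e :: 'w \<Rightarrow> 'x ghat_point. inj_on e W"
    unfolding ghat_iso_def bij_betw_def by blast
  then show ?thesis unfolding code_def by (rule someI_ex)
qed

lemma code_action_code: "w \<in> W \<Longrightarrow> code_action g (code w) = code (\<alpha> g w)"
  unfolding code_action_def using inj_code by simp

lemma code_action_image: "S \<subseteq> W \<Longrightarrow> code_action g ` code ` S = code ` \<alpha> g ` S"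
  unfolding image_image by (intro image_cong refl) (auto simp: code_action_code)

lemma stable_code:
  "S \<subseteq> T \<Longrightarrow> T \<subseteq> W \<Longrightarrow> stable_under U \<alpha> S \<Longrightarrow>
    stable_under U (restrict_action code_action (code ` T)) (code ` S)"
proof -
  assume ST: "S \<subseteq> T" "T \<subseteq> W" and S: "stable_under U \<alpha> S"
  have "restrict_action code_action (code ` T) g ` code ` S = code_action g ` code ` S" for g
    unfolding restrict_action_def using ST(1) by (intro image_cong) auto
  then show ?thesis
    using S code_action_image[of S] ST unfolding stable_under_def by auto
qed

text \<open>No group among the arguments, so that sets stable under different open subgroups can
  occur in one equation. The choice is removed by \<open>vol_eq\<close>.\<close>

definition vol :: "'w set \<Rightarrow> 'k" where
  "vol S = ghat_value X G \<mu> (SOME U. opn U \<and> stable_under U \<alpha> S) S (restrict_action \<alpha> S)"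

text \<open>Two open subgroups that stabilize \<open>S\<close> turn its codes into G-hat-sets that
  are isomorphic by the identity, equivariantly under the intersection of the two groups;
  \<open>iso_invariant\<close> then equates their measures.\<close>

lemma
  assumes U: "opn U" and S: "S \<subseteq> W" "stable_under U \<alpha> S"
  shows ghat_set_code: "ghat_set X G U (code ` S) (restrict_action code_action (code ` S))"
    and vol_eq_code: "vol S = \<mu> U (code ` S) (restrict_action code_action (code ` S))"
    and vol_eq: "vol S = ghat_value X G \<mu> U S (restrict_action \<alpha> S)"
proof -
  let ?B = "restrict_action code_action (code ` S)"
  have inj: "inj_on code S" using inj_code S(1) by (rule inj_on_subset)
  have ext: "?B g \<in> extensional (code ` S)" for g
    by (simp add: restrict_action_def)
  have eq: "?B g (code w) = code (restrict_action \<alpha> S g w)" if "w \<in> S" for g w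
    using that S(1) by (auto simp: restrict_action_def code_action_code)
  have copy: "ghat_set X G V (code ` S) ?B"
      "ghat_value X G \<mu> V S (restrict_action \<alpha> S) = \<mu> V (code ` S) ?B"
    if V: "opn V" "stable_under V \<alpha> S" for V
    using ghat_set_image(1)[OF ghat_set_restrict[OF V(1) S(1) V(2)] inj, of ?B]
      ghat_value_image[OF ghat_set_restrict[OF V(1) S(1) V(2)] inj, of ?B] ext eq by auto
  show "ghat_set X G U (code ` S) ?B" by (rule copy(1)[OF U S(2)])
  define V where "V = (SOME U. opn U \<and> stable_under U \<alpha> S)"
  have V: "opn V" "stable_under V \<alpha> S"
    using someI[of "\<lambda>U. opn U \<and> stable_under U \<alpha> S" U] U S unfolding V_def by auto
  have "ghat_iso X G V (code ` S) ?B U (code ` S) ?B"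
    unfolding ghat_iso_def using opn_Int[OF V(1) U]
    by (intro exI[of _ "V \<inter> U"] exI[of _ id]) auto
  then have "\<mu> V (code ` S) ?B = \<mu> U (code ` S) ?B"
    by (rule iso_invariant[OF copy(1)[OF V] copy(1)[OF U S(2)]])
  then show 1: "vol S = \<mu> U (code ` S) ?B"
    using copy(2)[OF V] unfolding vol_def V_def by simp
  show "vol S = ghat_value X G \<mu> U S (restrict_action \<alpha> S)"
    unfolding 1 by (rule copy(2)[OF U S(2), symmetric])
qed

text \<open>Allows any encoding \<open>e\<close> in place of \<open>code\<close>. The invariance
  properties of the volume arise by choosing \<open>e\<close> so that the codes of one set become
  those of another.\<close>

lemma vol_eq_image:
  fixes e :: "'w \<Rightarrow> 'x ghat_point"
  assumes U: "opn U" and S: "S \<subseteq> W" "stable_under U \<alpha> S"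
    and e: "inj_on e S" and ext: "\<And>g. g \<in> U \<Longrightarrow> \<beta> g \<in> extensional (e ` S)"
    and eq: "\<And>g w. g \<in> U \<Longrightarrow> w \<in> S \<Longrightarrow> \<beta> g (e w) = e (\<alpha> g w)"
  shows "vol S = \<mu> U (e ` S) \<beta>"
  unfolding vol_eq[OF U S]
  by (rule ghat_value_image[OF ghat_set_restrict[OF U S] e ext])
    (auto simp: eq restrict_action_def)

abbreviation "hat_subset \<equiv> ghat_subset X G W \<alpha>"

lemma hat_subsetI: "opn U \<Longrightarrow> S \<subseteq> W \<Longrightarrow> stable_under U \<alpha> S \<Longrightarrow> hat_subset S"
  unfolding ghat_subset_def by blast

lemma hat_subsetE:
  assumes "hat_subset S"
  obtains U where "opn U" "S \<subseteq> W" "stable_under U \<alpha> S"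
  using assms unfolding ghat_subset_def by blast

text \<open>One inclusion suffices because the inclusion for \<open>iv g\<close> gives the reverse
  one for \<open>g\<close>.\<close>

lemma stable_underI:
  assumes "opn U" "\<And>g w. g \<in> U \<Longrightarrow> w \<in> S \<Longrightarrow> \<alpha> g w \<in> S" "S \<subseteq> W"
  shows "stable_under U \<alpha> S"
  unfolding stable_under_def
proof (intro ballI equalityI subsetI)
  fix g w assume g: "g \<in> U" and w: "w \<in> S"
  then have "\<alpha> (iv g) w \<in> S" using assms opn_inv by blast
  moreover have "w = \<alpha> g (\<alpha> (iv g) w)" using act_inv' opn_in_G assms(1,3) g w by auto
  ultimately show "w \<in> \<alpha> g ` S" by blast
qed (use assms(2) in auto)

lemma stable_under_iff:
  "opn U \<Longrightarrow> stable_under U \<alpha> S \<Longrightarrow> S \<subseteq> W \<Longrightarrow> g \<in> U \<Longrightarrow> w \<in> W \<Longrightarrow> \<alpha> g w \<in> S \<longleftrightarrow> w \<in> S"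
  by (metis act_inv opn_in_G opn_inv stable_underD)

lemma vol_disjoint_Un:
  assumes S: "hat_subset S" and T: "hat_subset T" and "S \<inter> T = {}"
  shows "vol (S \<union> T) = vol S + vol T"
proof -
  obtain U1 where U1: "opn U1" "S \<subseteq> W" "stable_under U1 \<alpha> S" by (rule hat_subsetE[OF S])
  obtain U2 where U2: "opn U2" "T \<subseteq> W" "stable_under U2 \<alpha> T" by (rule hat_subsetE[OF T])
  define U where "U = U1 \<inter> U2"
  have U: "opn U" unfolding U_def by (rule opn_Int[OF U1(1) U2(1)])
  have st: "stable_under U \<alpha> S" "stable_under U \<alpha> T"
    using U1 U2 unfolding U_def by (auto elim!: stable_under_mono)
  have stu: "stable_under U \<alpha> (S \<union> T)" using st unfolding stable_under_def by blast
  have W: "S \<union> T \<subseteq> W" using U1 U2 by blast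
  let ?B = "restrict_action code_action (code ` (S \<union> T))"
  have "vol (S \<union> T) = \<mu> U (code ` S \<union> code ` T) ?B"
    unfolding vol_eq_code[OF U W stu] image_Un ..
  also have "\<dots> = \<mu> U (code ` S) (restrict_action ?B (code ` S))
      + \<mu> U (code ` T) (restrict_action ?B (code ` T))"
  proof (rule additive)
    show "ghat_set X G U (code ` S \<union> code ` T) ?B"
      using ghat_set_code[OF U W stu] by (simp only: image_Un)
    show "code ` S \<inter> code ` T = {}"
      using inj_on_image_Int[OF inj_code U1(2) U2(2)] \<open>S \<inter> T = {}\<close> by simp
    show "stable_under U ?B (code ` S)" "stable_under U ?B (code ` T)"
      using st W by (auto intro!: stable_code)
  qed
  also have "\<dots> = vol S + vol T"
    using U U1 U2 st by (simp add: restrict_action_restrict_action image_mono vol_eq_code)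
  finally show ?thesis .
qed

lemma hat_subset_empty: "hat_subset {}"
  by (rule hat_subsetI[OF opn_G]) (auto simp: stable_under_def)

lemma vol_empty [simp]: "vol {} = 0"
  using vol_disjoint_Un[OF hat_subset_empty hat_subset_empty]
  by (metis Int_empty_left Un_empty_left add_cancel_left_right)

lemma hat_subset_singleton: "w \<in> W \<Longrightarrow> hat_subset {w}"
  by (rule hat_subsetI[OF opn_stab]) (auto simp: stable_under_def)

lemma vol_singleton: "w \<in> W \<Longrightarrow> vol {w} = 1"
proof -
  assume w: "w \<in> W"
  have st: "stable_under {g \<in> G. \<alpha> g w = w} \<alpha> {w}" by (auto simp: stable_under_def)
  show ?thesis
    using vol_eq_code[OF opn_stab[OF w] _ st] ghat_set_code[OF opn_stab[OF w] _ st] point w by simp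
qed

lemma stable_under_conj:
  assumes g: "g \<in> G" and U: "opn U" and S: "S \<subseteq> W" "stable_under U \<alpha> S"
  shows "stable_under (conj_subgroup X g U) \<alpha> (\<alpha> g ` S)"
proof (rule stable_underI[OF opn_conj[OF g U]])
  fix h w assume h: "h \<in> conj_subgroup X g U" and "w \<in> \<alpha> g ` S"
  then obtain s where s: "s \<in> S" "w = \<alpha> g s" by blast
  have hG: "h \<in> G" using h conj_subgroup_subset[OF g U] by blast
  have "iv g \<odot> h \<odot> g \<in> U" using h conj_subgroup_iff[OF g U hG] by simp
  then have "\<alpha> (iv g \<odot> h \<odot> g) s \<in> S" using S(2) s(1) stable_underD by metis
  moreover have "\<alpha> h w = \<alpha> g (\<alpha> (iv g \<odot> h \<odot> g) s)"
    using s S(1) g hG by (simp add: act_mult act_closed act_inv' G_inv G_mult subset_iff)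
  ultimately show "\<alpha> h w \<in> \<alpha> g ` S" by blast
qed (use act_closed[OF g] S in auto)

lemma hat_subset_act: "g \<in> G \<Longrightarrow> hat_subset S \<Longrightarrow> hat_subset (\<alpha> g ` S)"
proof (erule hat_subsetE)
  fix U assume g: "g \<in> G" and U: "opn U" "S \<subseteq> W" "stable_under U \<alpha> S"
  show "hat_subset (\<alpha> g ` S)"
    by (rule hat_subsetI[OF opn_conj[OF g U(1)] _ stable_under_conj[OF g U]])
      (use act_closed[OF g] U(2) in auto)
qed

text \<open>Encoding the translate of \<open>S\<close> by
  \<open>code \<circ> \<alpha> (iv g)\<close> turns it into the codes of \<open>S\<close> with the
  conjugated action, which is the situation of \<open>conj_invariant\<close>.\<close>

lemma vol_act:
  assumes g: "g \<in> G" and "hat_subset S"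
  shows "vol (\<alpha> g ` S) = vol S"
proof -
  obtain U where U: "opn U" and S: "S \<subseteq> W" "stable_under U \<alpha> S" by (rule hat_subsetE[OF assms(2)])
  let ?B = "restrict_action code_action (code ` S)"
  let ?e = "code \<circ> \<alpha> (iv g)"
  have im: "?e ` \<alpha> g ` S = code ` S"
    using S(1) g by (auto simp: image_image act_inv subset_iff intro!: image_cong)
  have "vol (\<alpha> g ` S) = \<mu> (conj_subgroup X g U) (?e ` \<alpha> g ` S) (conj_action X g ?B)"
  proof (rule vol_eq_image[OF opn_conj[OF g U] _ stable_under_conj[OF g U S]])
    show gW: "\<alpha> g ` S \<subseteq> W" using act_closed[OF g] S by auto
    show "inj_on ?e (\<alpha> g ` S)"
      using gW inj_on_subset[OF act_inj[OF G_inv[OF g]] gW] inj_code act_closed[OF G_inv[OF g]]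
      by (intro comp_inj_on) (auto intro: inj_on_subset)
    show "conj_action X g ?B h \<in> extensional (?e ` \<alpha> g ` S)" for h
      unfolding im conj_action_def restrict_action_def by (rule restrict_extensional)
    fix h w assume h: "h \<in> conj_subgroup X g U" and "w \<in> \<alpha> g ` S"
    then obtain s where s: "s \<in> S" "w = \<alpha> g s" by blast
    have hG: "h \<in> G" using h conj_subgroup_subset[OF g U] by blast
    show "conj_action X g ?B h (?e w) = ?e (\<alpha> h w)"
      using s S(1) g hG
      by (simp add: conj_action_def restrict_action_def act_inv code_action_code act_mult
          act_closed G_inv G_mult subset_iff)
  qed
  also have "\<dots> = \<mu> U (code ` S) ?B"
    unfolding im by (rule conj_invariant[OF ghat_set_code[OF U S] g])
  also have "\<dots> = vol S" by (rule vol_eq_code[OF U S, symmetric])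
  finally show ?thesis .
qed

end

section \<open>Volumes under equivariant bijections and projections\<close>

locale measured_pair = S: measured_set X G \<mu> W1 \<alpha>1 + T: measured_set X G \<mu> W2 \<alpha>2
  for X :: "'x set" and G :: "('x \<Rightarrow> 'x) set" and \<mu> :: "('x, 'k::field) ghat_function"
    and W1 :: "'w set" and \<alpha>1 :: "('x \<Rightarrow> 'x) \<Rightarrow> 'w \<Rightarrow> 'w"
    and W2 :: "'z set" and \<alpha>2 :: "('x \<Rightarrow> 'x) \<Rightarrow> 'z \<Rightarrow> 'z"
begin

text \<open>With the encoding \<open>T.code \<circ> f\<close> of \<open>Z\<close> both volumes are
  the measure of the same codes with the same action. Equivariance is required only under
  \<open>U\<close> because the embedding of a slice \<open>{a} \<times> W\<close> into a square
  commutes only with the stabilizer of \<open>a\<close>.\<close>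

lemma vol_bij:
  assumes U: "S.opn U" and Z: "Z \<subseteq> W1" "stable_under U \<alpha>1 Z"
    and inj: "inj_on f Z" and f: "f ` Z \<subseteq> W2"
    and eq: "\<And>g w. g \<in> U \<Longrightarrow> w \<in> Z \<Longrightarrow> f (\<alpha>1 g w) = \<alpha>2 g (f w)"
  shows "T.vol (f ` Z) = S.vol Z"
proof -
  have st: "stable_under U \<alpha>2 (f ` Z)"
    by (rule T.stable_underI[OF U _ f]) (auto simp: eq[symmetric] stable_underD[OF Z(2)])
  let ?B = "restrict_action T.code_action (T.code ` f ` Z)"
  have "S.vol Z = \<mu> U ((T.code \<circ> f) ` Z) ?B"
  proof (rule S.vol_eq_image[OF U Z])
    show "inj_on (T.code \<circ> f) Z"
      using inj inj_on_subset[OF T.inj_code f] by (rule comp_inj_on)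
    show "?B g \<in> extensional ((T.code \<circ> f) ` Z)" for g
      by (simp add: restrict_action_def image_comp)
    fix g w assume "g \<in> U" "w \<in> Z"
    then show "?B g ((T.code \<circ> f) w) = (T.code \<circ> f) (\<alpha>1 g w)"
      using f by (auto simp: restrict_action_def T.code_action_code eq)
  qed
  then show ?thesis by (simp add: T.vol_eq_code[OF U f st] image_comp)
qed

text \<open>The orbit \<open>C\<close> and its image are transitive \<open>U\<close>-sets, so this
  is the axiom \<open>fibration\<close> transferred from codes to volumes.\<close>

lemma vol_fibration:
  assumes U: "S.opn U" and w: "w \<in> W1"
    and f: "\<And>w. w \<in> W1 \<Longrightarrow> f w \<in> W2"
    and eq: "\<And>g w. g \<in> G \<Longrightarrow> w \<in> W1 \<Longrightarrow> f (\<alpha>1 g w) = \<alpha>2 g (f w)"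
  defines "C \<equiv> (\<lambda>g. \<alpha>1 g w) ` U"
  shows "S.vol C = S.vol {x \<in> C. f x = f w} * T.vol (f ` C)"
proof -
  let ?D = "f ` C" and ?F = "{x \<in> C. f x = f w}"
  have UG: "U \<subseteq> G" by (rule S.opn_subset[OF U])
  have C: "C \<subseteq> W1" unfolding C_def using S.act_closed w UG by auto
  have D: "?D \<subseteq> W2" using C f by auto
  have wC: "w \<in> C" unfolding C_def using S.act_one[OF w] S.opn_one[OF U] by (metis image_eqI)
  have stC: "stable_under U \<alpha>1 C"
  proof (rule S.stable_underI[OF U _ C])
    fix g x assume g: "g \<in> U" and "x \<in> C"
    then obtain h where h: "h \<in> U" "x = \<alpha>1 h w" unfolding C_def by blast
    then have "\<alpha>1 g x = \<alpha>1 (g \<otimes>\<^bsub>BijGroup X\<^esub> h) w" using g h(1) UG w by (simp add: S.act_mult subset_iff)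
    then show "\<alpha>1 g x \<in> C" unfolding C_def using S.opn_mult[OF U g h(1)] by blast
  qed
  have eqC: "f (\<alpha>1 g x) = \<alpha>2 g (f x)" if "g \<in> U" "x \<in> C" for g x
    using that eq UG C by auto
  have stD: "stable_under U \<alpha>2 ?D"
    by (rule T.stable_underI[OF U _ D]) (auto simp: eqC[symmetric] stable_underD[OF stC])
  let ?A1 = "restrict_action S.code_action (S.code ` C)"
  let ?A2 = "restrict_action T.code_action (T.code ` ?D)"
  let ?f = "\<lambda>p. T.code (f (inv_into W1 S.code p))"
  have f_code: "?f (S.code x) = T.code (f x)" if "x \<in> C" for x
    using that C S.inj_code by (simp add: subset_iff)
  have A1: "?A1 g (S.code x) = S.code (\<alpha>1 g x)" if "x \<in> C" for g x
    using that C by (auto simp: restrict_action_def S.code_action_code)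
  have A2: "?A2 g (T.code x) = T.code (\<alpha>2 g x)" if "x \<in> ?D" for g x
    using that D by (auto simp: restrict_action_def T.code_action_code)
  have trC: "\<exists>g\<in>U. \<alpha>1 g x = y" if xy: "x \<in> C" "y \<in> C" for x y
  proof -
    obtain g h where gh: "g \<in> U" "x = \<alpha>1 g w" "h \<in> U" "y = \<alpha>1 h w"
      using xy unfolding C_def by blast
    then have "\<alpha>1 (h \<otimes>\<^bsub>BijGroup X\<^esub> inv\<^bsub>BijGroup X\<^esub> g) x = y"
      using w UG S.G_inv
      by (simp add: subset_iff S.act_mult S.act_closed S.act_inv)
    then show ?thesis using gh S.opn_mult[OF U] S.opn_inv[OF U] by blast
  qed
  have tr1: "transitive_smooth_set X G U (S.code ` C) ?A1"
    unfolding transitive_smooth_set_def transitive_action_def transitive_action_axioms_def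
  proof (intro conjI)
    show g: "ghat_set X G U (S.code ` C) ?A1" by (rule S.ghat_set_code[OF U C stC])
    show "group_action (perm_group X U) (S.code ` C) ?A1" using g by (simp add: ghat_set_def)
  qed (use trC wC A1 in \<open>auto, metis\<close>)
  have tr2: "transitive_smooth_set X G U (T.code ` ?D) ?A2"
    unfolding transitive_smooth_set_def transitive_action_def transitive_action_axioms_def
  proof (intro conjI allI impI)
    show g: "ghat_set X G U (T.code ` ?D) ?A2" by (rule T.ghat_set_code[OF U D stD])
    show "group_action (perm_group X U) (T.code ` ?D) ?A2" using g by (simp add: ghat_set_def)
    fix p q assume "p \<in> T.code ` ?D" "q \<in> T.code ` ?D"
    then obtain x y where xy: "x \<in> C" "p = T.code (f x)" "y \<in> C" "q = T.code (f y)" by blast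
    then obtain g where "g \<in> U" "\<alpha>1 g x = y" using trC by blast
    then show "\<exists>g\<in>carrier (perm_group X U). ?A2 g p = q" using xy A2 eqC by auto
  qed (use wC in auto)
  let ?z = "T.code (f w)"
  let ?V = "stabilizer (perm_group X U) ?A2 ?z"
  \<comment> \<open>The axiom lets the stabilizer of a coded point act on the fiber. Injectivity of
    the codes identifies it with the stabilizer of \<open>f w\<close> in \<open>U\<close>, which
    shows that it is open.\<close>
  have V: "?V = U \<inter> {g \<in> G. \<alpha>2 g (f w) = f w}"
    unfolding stabilizer_perm_group using UG wC A2 f[OF w] T.act_closed inj_onD[OF T.inj_code]
    by auto
  have opnV: "S.opn ?V" unfolding V by (rule S.opn_Int[OF U T.opn_stab[OF f[OF w]]])
  have F: "{p \<in> S.code ` C. ?f p = ?z} = S.code ` ?F"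
    using f_code C f w inj_onD[OF T.inj_code] by (auto simp: subset_iff)
  have FW: "?F \<subseteq> W1" using C by auto
  have stF: "stable_under ?V \<alpha>1 ?F"
    by (rule S.stable_underI[OF opnV _ FW]) (use stable_underD[OF stC] eqC in \<open>auto simp: V\<close>)
  have "S.vol C = \<mu> U (S.code ` C) ?A1" by (rule S.vol_eq_code[OF U C stC])
  also have "\<dots> = \<mu> ?V {p \<in> S.code ` C. ?f p = ?z} (restrict_action ?A1 {p \<in> S.code ` C. ?f p = ?z})
      * \<mu> U (T.code ` ?D) ?A2"
  proof (rule S.fibration[OF tr1 tr2])
    show "?f \<in> S.code ` C \<rightarrow> T.code ` ?D" using f_code by auto
    show "\<forall>g\<in>U. \<forall>p\<in>S.code ` C. ?f (?A1 g p) = ?A2 g (?f p)"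
      using f_code A1 A2 eqC stable_underD[OF stC] by auto
    show "?z \<in> T.code ` ?D" using wC by blast
  qed
  also have "\<mu> U (T.code ` ?D) ?A2 = T.vol ?D" by (rule T.vol_eq_code[OF U D stD, symmetric])
  also have "\<mu> ?V {p \<in> S.code ` C. ?f p = ?z} (restrict_action ?A1 {p \<in> S.code ` C. ?f p = ?z}) = S.vol ?F"
    unfolding F using S.vol_eq_code[OF opnV FW stF]
    by (simp add: restrict_action_restrict_action image_mono)
  finally show ?thesis .
qed

end

section \<open>Integration and Fubini\<close>

context measured_set
begin

text \<open>Membership in \<open>S\<close> and in \<open>T\<close> is invariant under the
  intersection of their groups, hence so is every Boolean function \<open>P\<close> of the
  two.\<close>

lemma hat_subset_combine:
  assumes S: "hat_subset S" and T: "hat_subset T"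
    and comb: "A \<subseteq> W" "\<And>w. w \<in> W \<Longrightarrow> w \<in> A \<longleftrightarrow> P (w \<in> S) (w \<in> T)"
  shows "hat_subset A"
proof -
  obtain U where U: "opn U" "S \<subseteq> W" "stable_under U \<alpha> S" by (rule hat_subsetE[OF S])
  obtain V where V: "opn V" "T \<subseteq> W" "stable_under V \<alpha> T" by (rule hat_subsetE[OF T])
  have UV: "opn (U \<inter> V)" by (rule opn_Int[OF U(1) V(1)])
  show ?thesis
  proof (rule hat_subsetI[OF UV comb(1) stable_underI[OF UV _ comb(1)]])
    fix g w assume g: "g \<in> U \<inter> V" and w: "w \<in> A"
    have wW: "w \<in> W" "\<alpha> g w \<in> W" using w g comb(1) act_closed opn_in_G[OF UV] by auto
    have "\<alpha> g w \<in> S \<longleftrightarrow> w \<in> S" "\<alpha> g w \<in> T \<longleftrightarrow> w \<in> T"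
      using g wW stable_under_iff[OF U(1,3,2)] stable_under_iff[OF V(1,3,2)] by auto
    then show "\<alpha> g w \<in> A" using w comb(2) wW by simp
  qed
qed

lemma hat_subset_Un: "hat_subset S \<Longrightarrow> hat_subset T \<Longrightarrow> hat_subset (S \<union> T)"
  by (rule hat_subset_combine[where P = "(\<or>)"]) (auto simp: ghat_subset_def)

lemma hat_subset_Diff: "hat_subset S \<Longrightarrow> hat_subset T \<Longrightarrow> hat_subset (S - T)"
  by (rule hat_subset_combine[where P = "\<lambda>a b. a \<and> \<not> b"]) (auto simp: ghat_subset_def)

lemma vol_Union:
  assumes "finite \<C>" "\<And>C. C \<in> \<C> \<Longrightarrow> hat_subset C" "disjoint \<C>"
  shows "vol (\<Union>\<C>) = (\<Sum>C\<in>\<C>. vol C)"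
proof -
  have "hat_subset (\<Union>\<C>) \<and> vol (\<Union>\<C>) = (\<Sum>C\<in>\<C>. vol C)"
    using assms
  proof (induction \<C>)
    case (insert C \<C>)
    have IH: "hat_subset (\<Union>\<C>)" "vol (\<Union>\<C>) = (\<Sum>C\<in>\<C>. vol C)"
      using insert.IH insert.prems by (auto simp: pairwise_insert)
    have "C \<inter> \<Union>\<C> = {}"
      using insert.prems(2) insert.hyps(2) by (fastforce simp: pairwise_insert disjnt_def)
    then show ?case
      using IH insert.hyps insert.prems(1)[of C] vol_disjoint_Un[of C "\<Union>\<C>"] hat_subset_Un[of C "\<Union>\<C>"]
      by simp
  qed (simp add: hat_subset_empty)
  then show ?thesis ..
qed

abbreviation "orbs U \<equiv> orbits (perm_group X U) W \<alpha>"

lemma orbit_subset: "opn U \<Longrightarrow> C \<in> orbs U \<Longrightarrow> C \<subseteq> W"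
  using act_closed opn_in_G by (auto simp: orbits_perm_group)

lemma orbit_self: "opn U \<Longrightarrow> w \<in> W \<Longrightarrow> w \<in> (\<lambda>g. \<alpha> g w) ` U"
  using act_one[of w] opn_one by (metis image_eqI)

lemma orbit_nonempty: "opn U \<Longrightarrow> C \<in> orbs U \<Longrightarrow> C \<noteq> {}"
  using opn_one by (auto simp: orbits_perm_group)

lemma orbit_eq:
  assumes U: "opn U" and C: "C \<in> orbs U" and w: "w \<in> C"
  shows "C = (\<lambda>g. \<alpha> g w) ` U"
proof -
  obtain x where x: "x \<in> W" "C = (\<lambda>g. \<alpha> g x) ` U" using C unfolding orbits_perm_group by blast
  then obtain h where h: "h \<in> U" "w = \<alpha> h x" using w by blast
  note UG = opn_in_G[OF U]
  have "\<alpha> g x \<in> (\<lambda>g. \<alpha> g w) ` U" if "g \<in> U" for g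
  proof (rule image_eqI)
    show "\<alpha> g x = \<alpha> (g \<odot> iv h) w"
      using that h x by (simp add: act_mult act_closed act_inv G_inv UG)
  qed (intro opn_mult[OF U] opn_inv[OF U] that h)
  moreover have "\<alpha> g w \<in> (\<lambda>g. \<alpha> g x) ` U" if "g \<in> U" for g
  proof (rule image_eqI)
    show "\<alpha> g w = \<alpha> (g \<odot> h) x"
      using that h x by (simp add: act_mult UG)
  qed (intro opn_mult[OF U] that h)
  ultimately show ?thesis unfolding x(2) by blast
qed

lemma stable_orbit:
  assumes U: "opn U" and C: "C \<in> orbs U"
  shows "stable_under U \<alpha> C"
  by (rule stable_underI[OF U _ orbit_subset[OF U C]]) (use orbit_eq[OF U C] in blast)

lemma hat_subset_orbit: "opn U \<Longrightarrow> C \<in> orbs U \<Longrightarrow> hat_subset C"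
  using hat_subsetI orbit_subset stable_orbit by blast

lemma disjoint_orbs: "opn U \<Longrightarrow> disjoint (orbs U)"
  using orbit_eq by (intro disjointI) blast

lemma orbit_mem: "w \<in> W \<Longrightarrow> (\<lambda>g. \<alpha> g w) ` U \<in> orbs U"
  unfolding orbits_perm_group by blast

section \<open>Smooth functions and their integral\<close>

definition invariant_under :: "('x \<Rightarrow> 'x) set \<Rightarrow> ('w \<Rightarrow> 'b) \<Rightarrow> bool" where
  "invariant_under U f \<longleftrightarrow> (\<forall>g\<in>U. \<forall>w\<in>W. f (\<alpha> g w) = f w)"

definition smooth_fun :: "('w \<Rightarrow> 'b) \<Rightarrow> bool" where
  "smooth_fun f \<longleftrightarrow> (\<exists>U. opn U \<and> invariant_under U f)"

text \<open>Grouping by values instead of orbits leaves nothing to choose. A smooth \<open>f\<close>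
  is constant on finitely many orbits that cover \<open>W\<close>, so its range is finite and the
  sum is a genuine one.\<close>

definition integ :: "('w \<Rightarrow> 'k) \<Rightarrow> 'k" where
  "integ f = (\<Sum>c\<in>f ` W. c * vol {w \<in> W. f w = c})"

lemma integ_cong: "(\<And>w. w \<in> W \<Longrightarrow> f w = g w) \<Longrightarrow> integ f = integ g"
proof -
  assume "\<And>w. w \<in> W \<Longrightarrow> f w = g w"
  then have "f ` W = g ` W" "\<And>c. {w \<in> W. f w = c} = {w \<in> W. g w = c}" by auto
  then show ?thesis unfolding integ_def by simp
qed

lemma smooth_funI: "opn U \<Longrightarrow> (\<And>g w. g \<in> U \<Longrightarrow> w \<in> W \<Longrightarrow> f (\<alpha> g w) = f w) \<Longrightarrow> smooth_fun f"
  unfolding smooth_fun_def invariant_under_def by blast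

lemma smooth_funE:
  assumes "smooth_fun f"
  obtains U where "opn U" "invariant_under U f"
  using assms unfolding smooth_fun_def by blast

lemma smooth_fun2E:
  assumes "smooth_fun f" "smooth_fun g"
  obtains U where "opn U" "invariant_under U f" "invariant_under U g"
proof -
  obtain U where U: "opn U" "invariant_under U f" by (rule smooth_funE[OF assms(1)])
  obtain V where V: "opn V" "invariant_under V g" by (rule smooth_funE[OF assms(2)])
  show ?thesis
    by (rule that[OF opn_Int[OF U(1) V(1)]]) (use U V in \<open>auto simp: invariant_under_def\<close>)
qed

lemma hat_subset_level: "smooth_fun f \<Longrightarrow> hat_subset {w \<in> W. f w = c}"
proof (erule smooth_funE)
  fix U assume U: "opn U" "invariant_under U f"
  show "hat_subset {w \<in> W. f w = c}"
    by (rule hat_subsetI[OF U(1) _ stable_underI[OF U(1)]])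
      (use U(2) opn_in_G[OF U(1)] act_closed in \<open>auto simp: invariant_under_def\<close>)
qed

text \<open>Each level set is the disjoint union of the orbits on which \<open>f\<close> takes that
  value, so additivity of the volume converts one sum into the other. Since \<open>U\<close> and
  \<open>y\<close> are arbitrary, this contains the independence of choices in the formula for the
  operators.\<close>

lemma integ_orbits:
  assumes U: "opn U" and f: "invariant_under U f" and y: "\<And>C. C \<in> orbs U \<Longrightarrow> y C \<in> C"
  shows "integ f = (\<Sum>C\<in>orbs U. vol C * f (y C))"
proof -
  let ?O = "orbs U"
  have fin: "finite ?O" by (rule finite_orbits[OF U])
  have const: "f w = f (y C)" if C: "C \<in> ?O" and w: "w \<in> C" for C w
  proof -
    obtain g where "g \<in> U" "w = \<alpha> g (y C)" using orbit_eq[OF U C y[OF C]] w by blast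
    then show ?thesis
      using f orbit_subset[OF U C] y[OF C] by (auto simp: invariant_under_def)
  qed
  have "y C \<in> W" if "C \<in> ?O" for C using y[OF that] orbit_subset[OF U that] by blast
  moreover have "f w \<in> (\<lambda>C. f (y C)) ` ?O" if w: "w \<in> W" for w
    using const[OF orbit_mem[OF w] orbit_self[OF U w]] orbit_mem[OF w] by (rule image_eqI)
  ultimately have range: "f ` W = (\<lambda>C. f (y C)) ` ?O" by auto
  have "(\<Sum>C\<in>?O. vol C * f (y C))
      = (\<Sum>c\<in>f ` W. \<Sum>C | C \<in> ?O \<and> f (y C) = c. vol C * f (y C))"
    unfolding range by (rule sum.image_gen[OF fin])
  also have "\<dots> = (\<Sum>c\<in>f ` W. c * vol {w \<in> W. f w = c})"
  proof (rule sum.cong[OF refl])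
    fix c
    let ?C = "{C \<in> ?O. f (y C) = c}"
    have "\<Union>?C = {w \<in> W. f w = c}"
    proof (intro equalityI subsetI)
      fix w assume "w \<in> {w \<in> W. f w = c}"
      then have w: "w \<in> W" "f w = c" by auto
      have "(\<lambda>g. \<alpha> g w) ` U \<in> ?C"
        using const[OF orbit_mem[OF w(1)] orbit_self[OF U w(1)]] orbit_mem[OF w(1)] w(2) by simp
      then show "w \<in> \<Union>?C" using orbit_self[OF U w(1)] by blast
    qed (use const orbit_subset[OF U] in auto)
    moreover have "vol (\<Union>?C) = (\<Sum>C\<in>?C. vol C)"
      using fin hat_subset_orbit[OF U] pairwise_subset[OF disjoint_orbs[OF U], of ?C]
      by (intro vol_Union) auto
    ultimately show "(\<Sum>C | C \<in> ?O \<and> f (y C) = c. vol C * f (y C)) = c * vol {w \<in> W. f w = c}"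
      by (simp add: sum_distrib_left mult.commute)
  qed
  finally show ?thesis unfolding integ_def by simp
qed

lemma integ_orbits_some:
  assumes U: "opn U" and f: "invariant_under U f"
  shows "integ f = (\<Sum>C\<in>orbs U. vol C * f (SOME w. w \<in> C))"
  using orbit_nonempty[OF U] by (intro integ_orbits[OF U f]) (auto intro: some_in_eq[THEN iffD2])

text \<open>Additivity is not visible in the sum over values, but it is evident for the orbit sums
  of a common open subgroup.\<close>

lemma integ_add:
  assumes "smooth_fun f" "smooth_fun g"
  shows "integ (\<lambda>w. f w + g w) = integ f + integ g"
proof -
  obtain U where U: "opn U" "invariant_under U f" "invariant_under U g" by (rule smooth_fun2E[OF assms])
  then have "invariant_under U (\<lambda>w. f w + g w)" by (simp add: invariant_under_def)
  then show ?thesis using U by (simp add: integ_orbits_some sum.distrib distrib_left)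
qed

lemma integ_scale:
  assumes "smooth_fun f"
  shows "integ (\<lambda>w. c * f w) = c * integ f"
proof -
  obtain U where U: "opn U" "invariant_under U f" by (rule smooth_funE[OF assms])
  then have "invariant_under U (\<lambda>w. c * f w)" by (simp add: invariant_under_def)
  then show ?thesis using U by (simp add: integ_orbits_some sum_distrib_left mult.left_commute)
qed

lemma smooth_fun_const: "smooth_fun (\<lambda>w. c)"
  by (rule smooth_funI[OF opn_G]) simp

lemma smooth_fun_comp2:
  assumes "smooth_fun f" "smooth_fun g"
  shows "smooth_fun (\<lambda>w. F (f w) (g w))"
proof -
  obtain U where U: "opn U" "invariant_under U f" "invariant_under U g" by (rule smooth_fun2E[OF assms])
  show ?thesis by (rule smooth_funI[OF U(1)]) (use U in \<open>simp add: invariant_under_def\<close>)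
qed

lemma integ_0: "integ (\<lambda>w. 0) = 0"
  unfolding integ_def by (rule sum.neutral) auto

lemma integ_sum:
  assumes "finite I" "\<And>i. i \<in> I \<Longrightarrow> smooth_fun (f i)"
  shows "integ (\<lambda>w. \<Sum>i\<in>I. f i w) = (\<Sum>i\<in>I. integ (f i))"
proof -
  have "smooth_fun (\<lambda>w. \<Sum>i\<in>I. f i w) \<and> integ (\<lambda>w. \<Sum>i\<in>I. f i w) = (\<Sum>i\<in>I. integ (f i))"
    using assms
  proof (induction I)
    case (insert i I)
    then show ?case
      using smooth_fun_comp2[of "f i" "\<lambda>w. \<Sum>i\<in>I. f i w" "(+)"] by (simp add: integ_add)
  qed (simp add: integ_0 smooth_fun_const)
  then show ?thesis ..
qed

lemma smooth_indicator:
  assumes "hat_subset S"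
  shows "smooth_fun (\<lambda>w. if w \<in> S then c else d)"
proof -
  obtain U where U: "opn U" "S \<subseteq> W" "stable_under U \<alpha> S" by (rule hat_subsetE[OF assms])
  show ?thesis by (rule smooth_funI[OF U(1)]) (simp add: stable_under_iff[OF U(1,3,2)])
qed

lemma integ_indicator:
  assumes S: "hat_subset S"
  shows "integ (\<lambda>w. if w \<in> S then c else 0) = c * vol S"
proof -
  have "S \<subseteq> W" using S by (simp add: ghat_subset_def)
  show ?thesis
  proof (cases "c = 0")
    case False
    let ?f = "\<lambda>w. if w \<in> S then c else 0"
    \<comment> \<open>A value that is not attained has an empty level set, so both \<open>c\<close>
      and 0 may be listed. They have to be distinct, hence the separate case
      \<open>c = 0\<close>.\<close>
    have "integ ?f = (\<Sum>d\<in>{c, 0}. d * vol {w \<in> W. ?f w = d})"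
      unfolding integ_def
    proof (rule sum.mono_neutral_left)
      show "\<forall>d\<in>{c, 0} - ?f ` W. d * vol {w \<in> W. ?f w = d} = 0"
      proof
        fix d assume "d \<in> {c, 0} - ?f ` W"
        then have "{w \<in> W. ?f w = d} = {}" by auto
        then show "d * vol {w \<in> W. ?f w = d} = 0" by (simp only: vol_empty mult_zero_right)
      qed
    qed auto
    also have "\<dots> = c * vol {w \<in> W. ?f w = c}" using False by simp
    also have "{w \<in> W. ?f w = c} = S" using False \<open>S \<subseteq> W\<close> by auto
    finally show ?thesis .
  qed (simp add: integ_0 cong: if_cong)
qed

end

context measured_pair
begin

lemma integ_bij:
  assumes \<phi>: "bij_betw \<phi> W1 W2"
    and eq: "\<And>g w. g \<in> G \<Longrightarrow> w \<in> W1 \<Longrightarrow> \<phi> (\<alpha>1 g w) = \<alpha>2 g (\<phi> w)"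
    and f: "T.smooth_fun f"
  shows "S.integ (\<lambda>w. f (\<phi> w)) = T.integ f"
proof -
  have im: "\<phi> ` W1 = W2" and inj: "inj_on \<phi> W1" using \<phi> by (auto simp: bij_betw_def)
  obtain U where U: "S.opn U" "T.invariant_under U f" by (rule T.smooth_funE[OF f])
  have fU: "f (\<phi> (\<alpha>1 g w)) = f (\<phi> w)" if "g \<in> U" "w \<in> W1" for g w
    using that U(2) eq[of g w] S.opn_in_G[OF U(1)] im by (auto simp: T.invariant_under_def)
  have "T.vol {w \<in> W2. f w = c} = S.vol {w \<in> W1. f (\<phi> w) = c}" for c
  proof -
    have "T.vol (\<phi> ` {w \<in> W1. f (\<phi> w) = c}) = S.vol {w \<in> W1. f (\<phi> w) = c}"
    proof (rule vol_bij[OF U(1)])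
      show "stable_under U \<alpha>1 {w \<in> W1. f (\<phi> w) = c}"
        by (rule S.stable_underI[OF U(1)]) (use fU S.act_closed S.opn_in_G[OF U(1)] in auto)
    qed (use im inj eq S.opn_in_G[OF U(1)] in \<open>auto intro: inj_on_subset\<close>)
    also have "\<phi> ` {w \<in> W1. f (\<phi> w) = c} = {w \<in> W2. f w = c}" using im by auto
    finally show ?thesis .
  qed
  moreover have "(\<lambda>w. f (\<phi> w)) ` W1 = f ` W2" using im by auto
  ultimately show ?thesis unfolding S.integ_def T.integ_def by simp
qed

end

context measured_set
begin

text \<open>Translation by \<open>g\<close> need not commute with the action, so
  \<open>integ_bij\<close> does not apply. The level sets are translated by \<open>iv g\<close>, and
  \<open>vol_act\<close>, that is the conjugation axiom, compares their volumes.\<close>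

lemma integ_act:
  assumes g: "g \<in> G" and f: "smooth_fun f"
  shows "integ (\<lambda>w. f (\<alpha> g w)) = integ f"
proof -
  have "{w \<in> W. f w = c} = \<alpha> g ` {w \<in> W. f (\<alpha> g w) = c}" for c
  proof (intro equalityI subsetI)
    fix w assume "w \<in> {w \<in> W. f w = c}"
    then have "w = \<alpha> g (\<alpha> (iv g) w)" "\<alpha> (iv g) w \<in> W" "f w = c"
      using g by (auto simp: act_inv' act_closed G_inv)
    then show "w \<in> \<alpha> g ` {w \<in> W. f (\<alpha> g w) = c}" by auto
  qed (use act_closed[OF g] in auto)
  moreover have "{w \<in> W. f (\<alpha> g w) = c} = \<alpha> (iv g) ` {w \<in> W. f w = c}" for c
  proof (intro equalityI subsetI)
    fix w assume "w \<in> {w \<in> W. f (\<alpha> g w) = c}"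
    then have "w = \<alpha> (iv g) (\<alpha> g w)" "\<alpha> g w \<in> W" "f (\<alpha> g w) = c"
      using g by (auto simp: act_inv act_closed)
    then show "w \<in> \<alpha> (iv g) ` {w \<in> W. f w = c}" by blast
  qed (use act_closed[OF G_inv[OF g]] act_inv'[OF g] in auto)
  then have "vol {w \<in> W. f (\<alpha> g w) = c} = vol {w \<in> W. f w = c}" for c
    using vol_act[OF G_inv[OF g] hat_subset_level[OF f]] by simp
  moreover have "(\<lambda>w. f (\<alpha> g w)) ` W = f ` W"
    using act_image[OF g] by (metis image_image)
  ultimately show ?thesis unfolding integ_def by simp
qed

section \<open>The diagonal action on the square and Fubini's theorem\<close>

definition square_action :: "('x \<Rightarrow> 'x) \<Rightarrow> 'w \<times> 'w \<Rightarrow> 'w \<times> 'w" where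
  "square_action g = restrict (map_prod (\<alpha> g) (\<alpha> g)) (W \<times> W)"

lemma square_action_apply:
  "x \<in> W \<Longrightarrow> y \<in> W \<Longrightarrow> square_action g (x, y) = (\<alpha> g x, \<alpha> g y)"
  by (simp add: square_action_def)

text \<open>Up to \<open>G\<close> the first entry of a pair is the representative of a
  \<open>G\<close>-orbit, and the second can then be moved by the stabilizer of the first to the
  representative of an orbit of that stabilizer. The stabilizer is open, so
  \<open>finite_orbits\<close> bounds the second choice as well.\<close>

lemma finite_orbits_square: "finite (orbits (perm_group X G) (W \<times> W) square_action)"
proof -
  define x where "x C = (SOME w. w \<in> C)" for C :: "'w set"
  have x: "x C \<in> C" if "C \<noteq> {}" for C using that unfolding x_def by (rule some_in_eq[THEN iffD2])
  define V where "V w = {g \<in> G. \<alpha> g w = w}" for w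
  have V: "opn (V w)" if "w \<in> W" for w unfolding V_def by (rule opn_stab[OF that])
  have xW: "x C \<in> W" if "opn U" "C \<in> orbs U" for U C
    using x[OF orbit_nonempty[OF that]] orbit_subset[OF that] by blast
  let ?I = "SIGMA C:orbs G. orbs (V (x C))"
  let ?h = "\<lambda>(C, D). (\<lambda>g. square_action g (x C, x D)) ` G"
  have "orbits (perm_group X G) (W \<times> W) square_action \<subseteq> ?h ` ?I"
  proof
    fix T assume "T \<in> orbits (perm_group X G) (W \<times> W) square_action"
    then obtain a b where ab: "a \<in> W" "b \<in> W" "T = (\<lambda>g. square_action g (a, b)) ` G"
      unfolding orbits_perm_group by blast
    define C where "C = (\<lambda>g. \<alpha> g a) ` G"
    have C: "C \<in> orbs G" unfolding C_def by (rule orbit_mem[OF ab(1)])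
    note xC = xW[OF opn_G C]
    have aC: "a \<in> C" unfolding C_def by (rule orbit_self[OF opn_G ab(1)])
    have "C = (\<lambda>g. \<alpha> g (x C)) ` G" by (rule orbit_eq[OF opn_G C x[OF orbit_nonempty[OF opn_G C]]])
    then obtain h where h: "h \<in> G" "a = \<alpha> h (x C)" using aC by blast
    define D where "D = (\<lambda>g. \<alpha> g (\<alpha> (iv h) b)) ` V (x C)"
    have hb: "\<alpha> (iv h) b \<in> W" using h ab act_closed G_inv by blast
    have D: "D \<in> orbs (V (x C))" unfolding D_def by (rule orbit_mem[OF hb])
    note xD = xW[OF V[OF xC] D]
    have "x D \<in> D" by (rule x[OF orbit_nonempty[OF V[OF xC] D]])
    then obtain k where k: "k \<in> V (x C)" "x D = \<alpha> k (\<alpha> (iv h) b)" unfolding D_def by blast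
    then have kG: "k \<in> G" "\<alpha> k (x C) = x C" by (auto simp: V_def)
    \<comment> \<open>The element \<open>h \<odot> iv k\<close> carries the representing pair to
      \<open>(a, b)\<close>: \<open>iv k\<close> fixes \<open>x C\<close> and takes
      \<open>x D\<close> to \<open>\<alpha> (iv h) b\<close>, and \<open>h\<close> takes these two
      points to \<open>a\<close> and \<open>b\<close>.\<close>
    have eq: "square_action (g \<odot> (h \<odot> iv k)) (x C, x D) = square_action g (a, b)" if "g \<in> G" for g
    proof -
      have "\<alpha> (iv k) (x C) = x C" using act_inv[OF kG(1) xC] kG(2) by simp
      moreover have "\<alpha> (iv k) (x D) = \<alpha> (iv h) b" using act_inv[OF kG(1) hb] k(2) by simp
      ultimately show ?thesis
        using that h ab xC xD kG hb
        by (simp add: square_action_apply act_mult act_closed G_inv G_mult act_inv')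
    qed
    have "(\<lambda>g. square_action g (x C, x D)) ` G = T"
    proof (intro equalityI subsetI)
      fix p assume "p \<in> T"
      then obtain g where "g \<in> G" "p = square_action g (a, b)" using ab(3) by blast
      then show "p \<in> (\<lambda>g. square_action g (x C, x D)) ` G"
        using eq[of g] h kG G_mult G_inv by (metis image_eqI)
    next
      fix p assume "p \<in> (\<lambda>g. square_action g (x C, x D)) ` G"
      then obtain g where g: "g \<in> G" "p = square_action g (x C, x D)" by blast
      let ?g = "g \<odot> iv (h \<odot> iv k)"
      have hk: "h \<odot> iv k \<in> G" using h kG G_mult G_inv by blast
      have "?g \<odot> (h \<odot> iv k) = g"
        using g(1) hk by (simp add: B.m_assoc G_carrier)
      then show "p \<in> T" using eq[of ?g] g ab(3) G_mult[OF g(1) G_inv[OF hk]] by auto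
    qed
    then show "T \<in> ?h ` ?I" using C D by (intro image_eqI[of _ _ "(C, D)"]) auto
  qed
  moreover have "finite ?I"
    using finite_orbits[OF opn_G] finite_orbits[OF V[OF xW[OF opn_G]]] by (rule finite_SigmaI)
  ultimately show ?thesis by (rule finite_surj[rotated])
qed

text \<open>The type of codes holds a copy of every G-hat-set, so the given \<open>\<mu>\<close>
  also provides volumes and integrals on the square.\<close>

lemma measured_set_square: "measured_set X G \<mu> (W \<times> W) square_action"
proof -
  have "ghat_set X G G (W \<times> W) square_action"
  proof (rule ghat_setI[OF opn_G _ _ _ _ _ finite_orbits_square])
    show "square_action g \<in> extensional (W \<times> W)" for g
      unfolding square_action_def by (rule restrict_extensional)
    fix p assume p: "p \<in> W \<times> W"
    show "opn {g \<in> G. square_action g p = p}"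
    proof -
      have "{g \<in> G. square_action g p = p} = {g \<in> G. \<alpha> g (fst p) = fst p} \<inter> {g \<in> G. \<alpha> g (snd p) = snd p}"
        using p by (auto simp: square_action_apply)
      then show ?thesis using opn_Int[OF opn_stab opn_stab, of "fst p" "snd p"] p by auto
    qed
  qed (auto simp: square_action_apply act_closed act_one act_mult)
  then show ?thesis
    by (intro measured_set.intro smooth_set.intro smooth_set_axioms.intro
        measured_group_axioms oligomorphic_group_axioms)
qed

definition invariant2 :: "('x \<Rightarrow> 'x) set \<Rightarrow> ('w \<Rightarrow> 'w \<Rightarrow> 'b) \<Rightarrow> bool" where
  "invariant2 U F \<longleftrightarrow> (\<forall>g\<in>U. \<forall>x\<in>W. \<forall>y\<in>W. F (\<alpha> g x) (\<alpha> g y) = F x y)"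

text \<open>The group used here is the stabilizer of \<open>x\<close> in \<open>U\<close>, which
  varies with \<open>x\<close>.\<close>

lemma smooth_section:
  assumes U: "opn U" and F: "invariant2 U F" and x: "x \<in> W"
  shows "smooth_fun (F x)"
proof (rule smooth_funI[OF opn_Int[OF U opn_stab[OF x]]])
  fix g w assume g: "g \<in> U \<inter> {g \<in> G. \<alpha> g x = x}" and w: "w \<in> W"
  then have "F (\<alpha> g x) (\<alpha> g w) = F x w" using F x unfolding invariant2_def by blast
  then show "F x (\<alpha> g w) = F x w" using g by simp
qed

text \<open>Translating the integration variable by the same \<open>g\<close> turns the section at
  \<open>\<alpha> g x\<close> into the section at \<open>x\<close>.\<close>

lemma invariant_integ:
  assumes U: "opn U" and F: "invariant2 U F"
  shows "invariant_under U (\<lambda>x. integ (F x))"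
  unfolding invariant_under_def
proof (intro ballI)
  fix g x assume g: "g \<in> U" and x: "x \<in> W"
  note gG = opn_in_G[OF U g]
  have "integ (F (\<alpha> g x)) = integ (\<lambda>w. F (\<alpha> g x) (\<alpha> g w))"
    by (rule integ_act[OF gG smooth_section[OF U F act_closed[OF gG x]], symmetric])
  also have "\<dots> = integ (F x)"
    by (rule integ_cong) (use F g x in \<open>auto simp: invariant2_def\<close>)
  finally show "integ (F (\<alpha> g x)) = integ (F x)" .
qed

text \<open>By \<open>invariant_integ\<close> the inner integral is constant on the projection of
  \<open>T\<close>, equal to \<open>c\<close> times the volume of one fiber, and it vanishes
  elsewhere. The iterated integral is thus \<open>c\<close> times the volumes of fiber and base,
  whose product is the volume of \<open>T\<close> by \<open>vol_fibration\<close>.\<close>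

lemma integ_integ_orbit:
  assumes U: "opn U" and w: "w \<in> W \<times> W"
  defines "T \<equiv> (\<lambda>g. square_action g w) ` U"
  shows "integ (\<lambda>x. integ (\<lambda>y. if (x, y) \<in> T then c else 0))
    = c * measured_set.vol X G \<mu> square_action T"
proof -
  interpret Q: measured_set X G \<mu> "W \<times> W" square_action by (rule measured_set_square)
  interpret P1: measured_pair X G \<mu> "W \<times> W" square_action W \<alpha> ..
  interpret P2: measured_pair X G \<mu> W \<alpha> "W \<times> W" square_action ..
  obtain a b where ab: "a \<in> W" "b \<in> W" "w = (a, b)" using w by auto
  have T: "T \<in> Q.orbs U" unfolding T_def by (rule Q.orbit_mem[OF w])
  note TW = Q.orbit_subset[OF U T] and UG = opn_in_G[OF U]
  have stT: "(\<alpha> g x, \<alpha> g y) \<in> T \<longleftrightarrow> (x, y) \<in> T" if "g \<in> U" "x \<in> W" "y \<in> W" for g x y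
    using Q.stable_under_iff[OF U Q.stable_orbit[OF U T] TW that(1), of "(x, y)"] that
    by (simp add: square_action_apply)
  let ?F = "\<lambda>x y. if (x, y) \<in> T then c else 0"
  have F: "invariant2 U ?F" unfolding invariant2_def using stT by simp
  define V where "V = U \<inter> {g \<in> G. \<alpha> g a = a}"
  have V: "opn V" unfolding V_def by (rule opn_Int[OF U opn_stab[OF ab(1)]])
  let ?Ta = "{y \<in> W. (a, y) \<in> T}"
  have Ta: "?Ta \<subseteq> W" by auto
  have stTa: "stable_under V \<alpha> ?Ta"
    by (rule stable_underI[OF V _ Ta])
      (use stT[of _ a] ab UG act_closed in \<open>force simp: V_def\<close>)
  have a_int: "integ (?F a) = c * vol ?Ta"
  proof -
    have "integ (?F a) = integ (\<lambda>y. if y \<in> ?Ta then c else 0)"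
      by (rule integ_cong) simp
    then show ?thesis by (simp only: integ_indicator[OF hat_subsetI[OF V Ta stTa]])
  qed
  have fstT: "fst ` T = (\<lambda>g. \<alpha> g a) ` U"
    unfolding T_def image_image using ab by (intro image_cong) (simp_all add: square_action_apply)
  have x_int: "integ (?F x) = (if x \<in> fst ` T then c * vol ?Ta else 0)" if x: "x \<in> W" for x
  proof (cases "x \<in> fst ` T")
    case True
    then obtain g where "g \<in> U" "x = \<alpha> g a" unfolding fstT by blast
    then show ?thesis
      using True invariant_integ[OF U F] a_int ab(1) by (simp add: invariant_under_def)
  next
    case False
    then have "integ (?F x) = integ (\<lambda>y. 0)" by (intro integ_cong) force
    then show ?thesis using False by (simp add: integ_0)
  qed
  have "hat_subset (fst ` T)"
    unfolding fstT by (rule hat_subset_orbit[OF U orbit_mem[OF ab(1)]])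
  then have "integ (\<lambda>x. if x \<in> fst ` T then c * vol ?Ta else 0) = c * vol ?Ta * vol (fst ` T)"
    by (rule integ_indicator)
  moreover have "integ (\<lambda>x. integ (?F x)) = integ (\<lambda>x. if x \<in> fst ` T then c * vol ?Ta else 0)"
    by (rule integ_cong[OF x_int])
  ultimately have 1: "integ (\<lambda>x. integ (?F x)) = c * (vol ?Ta * vol (fst ` T))" by simp
  have "Q.vol T = Q.vol {p \<in> T. fst p = fst w} * vol (fst ` T)"
    unfolding T_def
    by (rule P1.vol_fibration[OF U w]) (auto simp: square_action_apply)
  \<comment> \<open>The fiber over \<open>a\<close> is a copy of the slice \<open>?Ta\<close>,
    equivariantly under \<open>V\<close>, which fixes \<open>a\<close>.\<close>
  also have "{p \<in> T. fst p = fst w} = Pair a ` ?Ta"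
    using ab TW by auto
  also have "Q.vol (Pair a ` ?Ta) = vol ?Ta"
    by (rule P2.vol_bij[OF V Ta stTa])
      (use ab in \<open>auto simp: inj_on_def V_def square_action_apply\<close>)
  finally show ?thesis using 1 by simp
qed

text \<open>The integral over the square prefers neither coordinate, so it can serve as the common
  value of both iterated integrals.\<close>

lemma integ_square:
  assumes U: "opn U" and F: "invariant2 U F"
  shows "integ (\<lambda>x. integ (F x)) = measured_set.integ X G \<mu> (W \<times> W) square_action (\<lambda>(x, y). F x y)"
proof -
  interpret Q: measured_set X G \<mu> "W \<times> W" square_action by (rule measured_set_square)
  let ?O = "Q.orbs U"
  let ?r = "\<lambda>T. SOME w. w \<in> T"
  let ?f = "\<lambda>(x, y). F x y"
  let ?i = "\<lambda>T x y. if (x, y) \<in> T then ?f (?r T) else 0"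
  have fin: "finite ?O" by (rule Q.finite_orbits[OF U])
  have f: "Q.invariant_under U ?f"
    unfolding Q.invariant_under_def using F by (auto simp: invariant2_def square_action_apply)
  have r: "?r T \<in> T" if "T \<in> ?O" for T
    using Q.orbit_nonempty[OF U that] by (rule some_in_eq[THEN iffD2])
  have i_inv: "invariant2 U (?i T)" if T: "T \<in> ?O" for T
    unfolding invariant2_def
  proof (intro ballI)
    fix g x y assume g: "g \<in> U" and xy: "x \<in> W" "y \<in> W"
    then show "?i T (\<alpha> g x) (\<alpha> g y) = ?i T x y"
      using Q.stable_under_iff[OF U Q.stable_orbit[OF U T] Q.orbit_subset[OF U T] g, of "(x, y)"]
      by (simp add: square_action_apply)
  qed
  have F_sum: "F x y = (\<Sum>T\<in>?O. ?i T x y)" if xy: "x \<in> W" "y \<in> W" for x y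
  proof -
    let ?T = "(\<lambda>g. square_action g (x, y)) ` U"
    have T: "?T \<in> ?O" using xy by (intro Q.orbit_mem) simp
    have xyT: "(x, y) \<in> ?T" using xy by (intro Q.orbit_self[OF U]) simp
    have "(\<Sum>T\<in>?O. ?i T x y) = (\<Sum>T\<in>{?T}. ?i T x y)"
      by (rule sum.mono_neutral_right[OF fin]) (use T Q.orbit_eq[OF U] in auto)
    also have "\<dots> = ?f (?r ?T)" using xyT by simp
    also obtain g where "g \<in> U" "?r ?T = square_action g (x, y)" using r[OF T] by blast
    then have "?f (?r ?T) = F x y" using f xy by (auto simp: Q.invariant_under_def)
    finally show ?thesis ..
  qed
  have "integ (\<lambda>x. integ (F x)) = integ (\<lambda>x. integ (\<lambda>y. \<Sum>T\<in>?O. ?i T x y))"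
    by (intro integ_cong F_sum)
  also have "\<dots> = integ (\<lambda>x. \<Sum>T\<in>?O. integ (?i T x))"
    by (intro integ_cong integ_sum fin smooth_section[OF U i_inv])
  also have "\<dots> = (\<Sum>T\<in>?O. integ (\<lambda>x. integ (?i T x)))"
    using invariant_integ[OF U i_inv] U by (intro integ_sum fin) (auto simp: smooth_fun_def)
  also have "\<dots> = (\<Sum>T\<in>?O. Q.vol T * ?f (?r T))"
  proof (rule sum.cong[OF refl])
    fix T assume T: "T \<in> ?O"
    then obtain w where w: "w \<in> W \<times> W" "T = (\<lambda>g. square_action g w) ` U"
      unfolding orbits_perm_group by blast
    show "integ (\<lambda>x. integ (?i T x)) = Q.vol T * ?f (?r T)"
      unfolding w(2) by (subst integ_integ_orbit[OF U w(1)]) (rule mult.commute)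
  qed
  also have "\<dots> = Q.integ ?f" by (rule Q.integ_orbits_some[OF U f, symmetric])
  finally show ?thesis .
qed

text \<open>Both orders are integrals over the square, of functions that correspond under the
  equivariant bijection \<open>prod.swap\<close>.\<close>

theorem integ_swap:
  assumes U: "opn U" and F: "invariant2 U F"
  shows "integ (\<lambda>x. integ (\<lambda>y. F x y)) = integ (\<lambda>y. integ (\<lambda>x. F x y))"
proof -
  interpret Q: measured_set X G \<mu> "W \<times> W" square_action by (rule measured_set_square)
  interpret P: measured_pair X G \<mu> "W \<times> W" square_action "W \<times> W" square_action ..
  have F': "invariant2 U (\<lambda>y x. F x y)" using F by (auto simp: invariant2_def)
  have smooth: "Q.smooth_fun (\<lambda>(x, y). F x y)"
    by (rule Q.smooth_funI[OF U]) (use F in \<open>auto simp: invariant2_def square_action_apply\<close>)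
  have "Q.integ (\<lambda>p. (\<lambda>(x, y). F x y) (prod.swap p)) = Q.integ (\<lambda>(x, y). F x y)"
  proof (rule P.integ_bij[OF _ _ smooth])
    show "bij_betw prod.swap (W \<times> W) (W \<times> W)"
      by (rule bij_betw_byWitness[where f' = prod.swap]) auto
  qed (auto simp: square_action_apply)
  also have "(\<lambda>p. (\<lambda>(x, y). F x y) (prod.swap p)) = (\<lambda>(y, x). F x y)" by auto
  finally show ?thesis using integ_square[OF U F] integ_square[OF U F'] by simp
qed

end

section \<open>The operators as integrals\<close>

lemma move_same: "y \<in> P i \<Longrightarrow> move i i y P = P"
  by (auto simp: move_def fun_eq_iff)

lemma move_apply:
  "move i j y P a = (if a = j then insert y (P j) else if a = i then P i - {y} else P a)"
  by (simp add: move_def)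

lemma move_commute: "y \<noteq> z \<Longrightarrow> move k l z (move i j y P) = move i j y (move k l z P)"
  by (rule ext) (auto simp: move_apply)

text \<open>The second move takes \<open>y\<close> out of part \<open>j\<close> again. For
  \<open>j \<noteq> i\<close> this undoes the insertion, because disjointness keeps \<open>y\<close>
  out of \<open>P j\<close>.\<close>

lemma move_move:
  assumes "disjoint_family P" "y \<in> P i"
  shows "move j l y (move i j y P) = move i l y P"
proof -
  have "y \<notin> P a" if "a \<noteq> i" for a
    using assms that by (auto simp: disjoint_family_on_def)
  then show ?thesis using assms(2) by (intro ext) (auto simp: move_apply)
qed

lemma mem_move_iff:
  assumes "disjoint_family P" "y \<in> P i"
  shows "z \<in> move i j y P k \<longleftrightarrow> (if z = y then k = j else z \<in> P k)"
proof -
  have "y \<notin> P a" if "a \<noteq> i" for a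
    using assms that by (auto simp: disjoint_family_on_def)
  then show ?thesis using assms(2) by (auto simp: move_apply)
qed

section \<open>Ordered partitions, tensors and the operators\<close>

context measured_set
begin

abbreviation "parts \<equiv> Part X G W \<alpha>"
abbreviation "act_part \<equiv> part_action \<alpha>"
abbreviation "act_tensor \<equiv> tensor_action X G W \<alpha>"
abbreviation "tensors \<equiv> tensor_power X G W \<alpha>"

lemma part_subset: "P \<in> parts \<Longrightarrow> P a \<subseteq> W"
  and part_hat_subset: "P \<in> parts \<Longrightarrow> hat_subset (P a)"
  and part_disjoint: "P \<in> parts \<Longrightarrow> disjoint_family P"
  by (auto simp: Part_def ghat_subset_def)

lemma act_part_mult:
  "P \<in> parts \<Longrightarrow> g \<in> G \<Longrightarrow> h \<in> G \<Longrightarrow> act_part (g \<odot> h) P = act_part g (act_part h P)"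
  unfolding part_action_def image_image
  using part_subset act_mult by (intro ext image_cong) blast+

lemma act_part_one: "P \<in> parts \<Longrightarrow> act_part \<one>\<^bsub>BijGroup X\<^esub> P = P"
  unfolding part_action_def using part_subset act_one by (intro ext) force

lemma act_part_closed:
  fixes P :: "'r::finite \<Rightarrow> 'w set"
  assumes P: "P \<in> parts" and g: "g \<in> G"
  shows "act_part g P \<in> parts"
proof -
  have "disjoint_family (act_part g P)"
    using part_disjoint[OF P] part_subset[OF P] inj_on_image_Int[OF act_inj[OF g]]
    unfolding disjoint_family_on_def part_action_def by (metis image_empty)
  moreover have "(\<Union>a. act_part g P a) = W"
  proof -
    have "(\<Union>a. act_part g P a) = \<alpha> g ` (\<Union>a. P a)" by (auto simp: part_action_def)
    then show ?thesis using P act_image[OF g] by (simp add: Part_def)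
  qed
  ultimately show ?thesis
    using hat_subset_act[OF g part_hat_subset[OF P]] by (simp add: Part_def part_action_def)
qed

lemma act_part_inv:
  assumes "P \<in> parts" "g \<in> G"
  shows "act_part (iv g) (act_part g P) = P" "act_part g (act_part (iv g) P) = P"
  using assms act_part_mult[of P "iv g" g] act_part_mult[of P g "iv g"] act_part_one[of P]
    G_inv[of g] G_carrier[of g] by auto

lemma mem_act_part_iff:
  assumes "P \<in> parts" "g \<in> G" "y \<in> W"
  shows "\<alpha> g y \<in> act_part g P a \<longleftrightarrow> y \<in> P a"
  unfolding part_action_def using inj_on_image_mem_iff[OF act_inj[OF assms(2)] assms(3) part_subset[OF assms(1)]] .

lemma act_part_move:
  assumes P: "P \<in> parts" and g: "g \<in> G" and y: "y \<in> W"
  shows "act_part g (move i j y P) = move i j (\<alpha> g y) (act_part g P)"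
proof
  fix a
  have "\<alpha> g ` (P i - {y}) = \<alpha> g ` P i - {\<alpha> g y}"
    using inj_on_image_set_diff[OF act_inj[OF g], of "P i" "{y}"] part_subset[OF P, of i] y by auto
  then show "act_part g (move i j y P) a = move i j (\<alpha> g y) (act_part g P) a"
    by (auto simp: part_action_def move_apply)
qed

text \<open>Points have open stabilizers, so adding or removing one keeps a set a
  G-hat-subset.\<close>

lemma move_closed:
  fixes P :: "'r::finite \<Rightarrow> 'w set"
  assumes P: "P \<in> parts" and y: "y \<in> P i"
  shows "move i j y P \<in> parts"
proof -
  note mem = mem_move_iff[OF part_disjoint[OF P] y]
  have yW: "y \<in> W" using y part_subset[OF P] by blast
  have "hat_subset (move i j y P a)" for a
    unfolding move_apply
    using hat_subset_Un[OF hat_subset_singleton[OF yW] part_hat_subset[OF P]]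
      hat_subset_Diff[OF part_hat_subset[OF P] hat_subset_singleton[OF yW]] part_hat_subset[OF P]
    by simp
  moreover have "disjoint_family (move i j y P)"
    using part_disjoint[OF P] unfolding disjoint_family_on_def disjoint_iff mem by metis
  moreover have "(\<Union>a. move i j y P a) = W"
  proof -
    have "(\<Union>a. move i j y P a) = (\<Union>a. P a)"
    proof (rule Set.set_eqI)
      show "z \<in> (\<Union>a. move i j y P a) \<longleftrightarrow> z \<in> (\<Union>a. P a)" for z
        using y by (auto simp: mem split: if_splits)
    qed
    then show ?thesis using P by (simp add: Part_def)
  qed
  ultimately show ?thesis by (simp add: Part_def)
qed

definition fixes_parts :: "('x \<Rightarrow> 'x) set \<Rightarrow> ('r \<Rightarrow> 'w set) \<Rightarrow> bool" where
  "fixes_parts U P \<longleftrightarrow> (\<forall>a. stable_under U \<alpha> (P a))"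

lemma fixes_partsD: "fixes_parts U P \<Longrightarrow> g \<in> U \<Longrightarrow> act_part g P = P"
  by (simp add: fixes_parts_def part_action_def stable_under_def)

lemma opn_INT:
  "finite I \<Longrightarrow> (\<And>i. i \<in> I \<Longrightarrow> opn (U i)) \<Longrightarrow> opn (G \<inter> (\<Inter>i\<in>I. U i))"
proof (induction I rule: finite_induct)
  case (insert i I)
  then have "opn (U i)" "opn (G \<inter> (\<Inter>i\<in>I. U i))" by auto
  then have "opn (U i \<inter> (G \<inter> (\<Inter>i\<in>I. U i)))" by (rule opn_Int)
  also have "U i \<inter> (G \<inter> (\<Inter>i\<in>I. U i)) = G \<inter> (\<Inter>i\<in>insert i I. U i)" by auto
  finally show ?case .
qed (simp add: opn_G)

lemma ex_fixes_parts:
  fixes P :: "'r::finite \<Rightarrow> 'w set"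
  assumes P: "P \<in> parts"
  shows "\<exists>U. opn U \<and> fixes_parts U P"
proof -
  have "\<exists>U. opn U \<and> stable_under U \<alpha> (P a)" for a
    using part_hat_subset[OF P] unfolding ghat_subset_def by blast
  then obtain U where U: "\<And>a. opn (U a)" "\<And>a. stable_under (U a) \<alpha> (P a)" by metis
  have "fixes_parts (G \<inter> (\<Inter>a\<in>UNIV. U a)) P"
    unfolding fixes_parts_def by (intro allI stable_under_mono[OF U(2)]) auto
  then show ?thesis using opn_INT[of UNIV U] U(1) by auto
qed

text \<open>Invariance without the inverse and the default value 0 of \<open>tensor_action\<close>;
  \<open>fixes_tensor_iff\<close> connects the two forms.\<close>

definition fixes_tensor :: "('x \<Rightarrow> 'x) set \<Rightarrow> (('r::finite \<Rightarrow> 'w set) \<Rightarrow> 'k) \<Rightarrow> bool" where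
  "fixes_tensor U v \<longleftrightarrow> (\<forall>g\<in>U. \<forall>P\<in>parts. v (act_part g P) = v P)"

lemma act_tensor_apply: "P \<in> parts \<Longrightarrow> act_tensor g v P = v (act_part (iv g) P)"
  and act_tensor_outside: "P \<notin> parts \<Longrightarrow> act_tensor g v P = 0"
  by (simp_all add: tensor_action_def fun_action_def)

lemma tensor_outside: "v \<in> tensors \<Longrightarrow> P \<notin> parts \<Longrightarrow> v P = 0"
  by (auto simp: tensor_power_def schwartz_space_def)

lemma fixes_tensor_iff:
  fixes v :: "('r::finite \<Rightarrow> 'w set) \<Rightarrow> 'k"
  assumes U: "opn U" and v: "\<And>P. P \<notin> parts \<Longrightarrow> v P = 0"
  shows "fixes_tensor U v \<longleftrightarrow> (\<forall>g\<in>U. act_tensor g v = v)"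
proof
  assume fix_v: "fixes_tensor U v"
  have "act_tensor g v P = v P" if "g \<in> U" for g P
    using fix_v v opn_inv[OF U that]
    by (cases "P \<in> parts") (auto simp: act_tensor_apply act_tensor_outside fixes_tensor_def)
  then show "\<forall>g\<in>U. act_tensor g v = v" by blast
next
  assume fix_v: "\<forall>g\<in>U. act_tensor g v = v"
  show "fixes_tensor U v"
    unfolding fixes_tensor_def
  proof (intro ballI)
    fix g and P :: "'r \<Rightarrow> 'w set" assume g: "g \<in> U" and P: "P \<in> parts"
    note gG = opn_in_G[OF U g]
    have "v (act_part g P) = act_tensor g v (act_part g P)" using fix_v g by simp
    also have "\<dots> = v P"
      by (simp add: act_tensor_apply act_part_closed[OF P gG] act_part_inv[OF P gG])
    finally show "v (act_part g P) = v P" .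
  qed
qed

lemma tensor_fixes_iff:
  "v \<in> tensors \<Longrightarrow> opn U \<Longrightarrow> fixes_tensor U v \<longleftrightarrow> (\<forall>g\<in>U. act_tensor g v = v)"
  by (rule fixes_tensor_iff) (simp_all add: tensor_outside)

lemma tensorsI:
  assumes "\<And>P. P \<notin> parts \<Longrightarrow> v P = 0" "opn U" "fixes_tensor U v"
  shows "v \<in> tensors"
proof -
  have "\<forall>g\<in>U. act_tensor g v = v" using fixes_tensor_iff[of U v] assms by simp
  then show ?thesis
    unfolding tensor_power_def schwartz_space_def tensor_action_def[symmetric]
    using assms(1,2) by (intro CollectI conjI exI[of _ U] allI impI)
qed

lemma tensorsE:
  assumes v: "v \<in> tensors"
  obtains U where "opn U" "fixes_tensor U v"
proof -
  obtain U where U: "opn U" "\<forall>g\<in>U. act_tensor g v = v"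
    using v unfolding tensor_power_def schwartz_space_def tensor_action_def[symmetric] by blast
  then have "fixes_tensor U v" using tensor_fixes_iff[OF v U(1)] by simp
  with U(1) show ?thesis by (rule that)
qed

text \<open>Extending the integrand by 0 off \<open>P i\<close> makes all integrals run over the
  same set \<open>W\<close>, so that Fubini on its square applies.\<close>

definition moved :: "'r \<Rightarrow> 'r \<Rightarrow> (('r \<Rightarrow> 'w set) \<Rightarrow> 'k) \<Rightarrow> ('r \<Rightarrow> 'w set) \<Rightarrow> 'w \<Rightarrow> 'k" where
  "moved i j v P y = (if y \<in> P i then v (move i j y P) else 0)"

definition E :: "'r::finite \<Rightarrow> 'r \<Rightarrow> (('r \<Rightarrow> 'w set) \<Rightarrow> 'k) \<Rightarrow> ('r \<Rightarrow> 'w set) \<Rightarrow> 'k" where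
  "E i j v P = (if P \<in> parts then integ (moved i j v P) else 0)"

lemma invariant_moved:
  assumes U: "opn U" "fixes_tensor U v" "fixes_parts U P" and P: "P \<in> parts"
  shows "invariant_under U (moved i j v P)"
  unfolding invariant_under_def
proof (intro ballI)
  fix g y assume g: "g \<in> U" and y: "y \<in> W"
  note gG = opn_in_G[OF U(1) g] and gP = fixes_partsD[OF U(3) g]
  have mem: "\<alpha> g y \<in> P i \<longleftrightarrow> y \<in> P i" using mem_act_part_iff[OF P gG y] gP by metis
  have "v (move i j (\<alpha> g y) P) = v (move i j y P)" if yi: "y \<in> P i"
  proof -
    have "move i j (\<alpha> g y) P = act_part g (move i j y P)" using act_part_move[OF P gG y] gP by metis
    then show ?thesis using U(2) move_closed[OF P yi] g by (simp add: fixes_tensor_def)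
  qed
  then show "moved i j v P (\<alpha> g y) = moved i j v P y" by (simp add: moved_def mem)
qed

lemma tensor_part_stabilizer:
  assumes v: "v \<in> tensors" and P: "P \<in> parts"
  obtains U where "opn U" "fixes_tensor U v" "fixes_parts U P"
proof -
  obtain U where U: "opn U" "fixes_tensor U v" by (rule tensorsE[OF v])
  obtain V where V: "opn V" "fixes_parts V P" using ex_fixes_parts[OF P] by blast
  have "fixes_tensor (U \<inter> V) v" using U by (simp add: fixes_tensor_def)
  moreover have "fixes_parts (U \<inter> V) P"
    using V(2) by (auto simp: fixes_parts_def intro: stable_under_mono)
  ultimately show ?thesis using that opn_Int[OF U(1) V(1)] by blast
qed

lemma smooth_moved: "v \<in> tensors \<Longrightarrow> P \<in> parts \<Longrightarrow> smooth_fun (moved i j v P)"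
  by (erule tensor_part_stabilizer) (auto simp: smooth_fun_def intro: invariant_moved)

text \<open>Moving \<open>y\<close> from a part to itself changes nothing, so the integrand is
  constant on \<open>P i\<close>.\<close>

lemma E_diag:
  assumes P: "P \<in> parts"
  shows "E i i v P = vol (P i) * v P"
proof -
  have "moved i i v P = (\<lambda>y. if y \<in> P i then v P else 0)"
    by (auto simp: moved_def move_same)
  then show ?thesis
    using integ_indicator[OF part_hat_subset[OF P, of i], of "v P"] P by (simp add: E_def mult.commute)
qed

lemma E_orbits:
  assumes U: "opn U" "fixes_tensor U v" "fixes_parts U P" and P: "P \<in> parts"
    and y: "\<And>C. C \<in> orbits (perm_group X U) (P i) \<alpha> \<Longrightarrow> y C \<in> C"
  shows "E i j v P = (\<Sum>C\<in>orbits (perm_group X U) (P i) \<alpha>. vol C * v (move i j (y C) P))"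
proof -
  let ?O = "orbits (perm_group X U) (P i) \<alpha>"
  \<comment> \<open>Representatives are given only for the orbits inside \<open>P i\<close>. Any
    choice serves for the others, because the integrand vanishes there.\<close>
  let ?y = "\<lambda>C. if C \<in> ?O then y C else (SOME w. w \<in> C)"
  have st: "stable_under U \<alpha> (P i)" using U(3) by (simp add: fixes_parts_def)
  have sub: "?O \<subseteq> orbs U"
    using part_subset[OF P] by (auto simp: orbits_perm_group)
  have in_P: "C \<subseteq> P i" if "C \<in> ?O" for C
    using that stable_underD[OF st] by (auto simp: orbits_perm_group)
  have out_P: "C \<inter> P i = {}" if C: "C \<in> orbs U" "C \<notin> ?O" for C
    using orbit_eq[OF U(1) C(1)] C(2) by (auto simp: orbits_perm_group)
  have some: "(SOME w. w \<in> C) \<in> C" if "C \<in> orbs U" for C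
    using orbit_nonempty[OF U(1) that] by (rule some_in_eq[THEN iffD2])
  have "E i j v P = (\<Sum>C\<in>orbs U. vol C * moved i j v P (?y C))"
    unfolding E_def using P y some
    by (simp add: integ_orbits[OF U(1) invariant_moved[OF U P], of ?y])
  also have "\<dots> = (\<Sum>C\<in>?O. vol C * moved i j v P (?y C))"
  proof (rule sum.mono_neutral_right[OF finite_orbits[OF U(1)] sub], intro ballI)
    fix C assume C: "C \<in> orbs U - ?O"
    then have "?y C \<notin> P i" using out_P[of C] some[of C] by auto
    then show "vol C * moved i j v P (?y C) = 0" by (simp add: moved_def)
  qed
  also have "\<dots> = (\<Sum>C\<in>?O. vol C * v (move i j (y C) P))"
    by (rule sum.cong) (use y in_P in \<open>auto simp: moved_def\<close>)
  finally show ?thesis .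
qed

text \<open>One direction says that all admissible choices give the same value, the other that an
  admissible choice exists. Together they make the \<open>THE\<close> in \<open>E_op\<close>
  well-defined.\<close>

lemma E_value_iff:
  assumes v: "v \<in> tensors" and P: "P \<in> parts"
  shows "E_value X G \<mu> W \<alpha> i j v P c \<longleftrightarrow> c = E i j v P"
proof (cases "i = j")
  case True
  have "E_value X G \<mu> W \<alpha> i j v P c \<longleftrightarrow>
      (\<exists>U. opn U \<and> stable_under U \<alpha> (P i) \<and> c = E i j v P)"
    unfolding E_value_def using True vol_eq[OF _ part_subset[OF P]] E_diag[OF P] by auto
  also have "\<dots> \<longleftrightarrow> c = E i j v P"
    using part_hat_subset[OF P, of i] by (auto simp: ghat_subset_def)
  finally show ?thesis .
next
  case False
  have sum_eq: "E i j v P = (\<Sum>C\<in>orbits (perm_group X U) (P i) \<alpha>.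
      ghat_value X G \<mu> U C (restrict_action \<alpha> C) * v (move i j (y C) P))"
    if U: "opn U" "fixes_tensor U v" "fixes_parts U P"
      and y: "\<forall>C\<in>orbits (perm_group X U) (P i) \<alpha>. y C \<in> C" for U y
  proof -
    have "orbits (perm_group X U) (P i) \<alpha> \<subseteq> orbs U"
      using part_subset[OF P] by (auto simp: orbits_perm_group)
    then have vol: "vol C = ghat_value X G \<mu> U C (restrict_action \<alpha> C)"
      if "C \<in> orbits (perm_group X U) (P i) \<alpha>" for C
      using that vol_eq[OF U(1) orbit_subset[OF U(1)] stable_orbit[OF U(1)]] by blast
    have "E i j v P = (\<Sum>C\<in>orbits (perm_group X U) (P i) \<alpha>. vol C * v (move i j (y C) P))"
      by (rule E_orbits[OF U P]) (use y in blast)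
    also have "\<dots> = (\<Sum>C\<in>orbits (perm_group X U) (P i) \<alpha>.
        ghat_value X G \<mu> U C (restrict_action \<alpha> C) * v (move i j (y C) P))"
      by (rule sum.cong) (simp_all add: vol)
    finally show ?thesis .
  qed
  show ?thesis
  proof
    assume "E_value X G \<mu> W \<alpha> i j v P c"
    then obtain U y where U: "opn U" "\<forall>g\<in>U. act_tensor g v = v" "\<forall>a. stable_under U \<alpha> (P a)"
      and y: "\<forall>C\<in>orbits (perm_group X U) (P i) \<alpha>. y C \<in> C"
      and c: "c = (\<Sum>C\<in>orbits (perm_group X U) (P i) \<alpha>.
          ghat_value X G \<mu> U C (restrict_action \<alpha> C) * v (move i j (y C) P))"
      using False unfolding E_value_def by auto
    have "fixes_tensor U v" using tensor_fixes_iff[OF v U(1)] U(2) by blast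
    moreover have "fixes_parts U P" using U(3) by (simp add: fixes_parts_def)
    ultimately show "c = E i j v P" using c sum_eq[OF U(1) _ _ y] by simp
  next
    assume c: "c = E i j v P"
    obtain U where U: "opn U" "fixes_tensor U v" "fixes_parts U P"
      by (rule tensor_part_stabilizer[OF v P])
    let ?y = "\<lambda>C. SOME w. w \<in> C"
    have y: "\<forall>C\<in>orbits (perm_group X U) (P i) \<alpha>. ?y C \<in> C"
    proof
      fix C assume "C \<in> orbits (perm_group X U) (P i) \<alpha>"
      then have "C \<noteq> {}" using opn_one[OF U(1)] by (auto simp: orbits_perm_group)
      then show "?y C \<in> C" by (rule some_in_eq[THEN iffD2])
    qed
    have "\<forall>g\<in>U. act_tensor g v = v"
      using tensor_fixes_iff[OF v U(1)] U(2) by blast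
    moreover have "\<forall>a. stable_under U \<alpha> (P a)" using U(3) by (simp add: fixes_parts_def)
    ultimately show "E_value X G \<mu> W \<alpha> i j v P c"
      unfolding E_value_def if_not_P[OF False] c
      using U(1) y sum_eq[OF U y] by (intro exI[of _ U] exI[of _ ?y] conjI)
  qed
qed

lemma E_op_eq:
  assumes v: "v \<in> tensors"
  shows "E_op X G \<mu> W \<alpha> i j v = E i j v"
proof
  fix P
  show "E_op X G \<mu> W \<alpha> i j v P = E i j v P"
  proof (cases "P \<in> parts")
    case P: True
    have "E_value X G \<mu> W \<alpha> i j v P = (\<lambda>c. c = E i j v P)"
      using E_value_iff[OF v P] by blast
    then show ?thesis using P by (simp add: E_op_def)
  qed (simp add: E_op_def E_def)
qed

text \<open>Substituting \<open>\<alpha> (iv g) y\<close> for the moved point \<open>y\<close> is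
  allowed by \<open>integ_act\<close>, and moving points is compatible with the action on
  tuples.\<close>

lemma E_act_tensor:
  assumes v: "v \<in> tensors" and g: "g \<in> G"
  shows "E i j (act_tensor g v) = act_tensor g (E i j v)"
proof
  fix P
  show "E i j (act_tensor g v) P = act_tensor g (E i j v) P"
  proof (cases "P \<in> parts")
    case P: True
    note gi = G_inv[OF g]
    note gP = act_part_closed[OF P gi]
    have "integ (moved i j v (act_part (iv g) P))
        = integ (\<lambda>y. moved i j v (act_part (iv g) P) (\<alpha> (iv g) y))"
      by (rule integ_act[OF gi smooth_moved[OF v gP], symmetric])
    also have "\<dots> = integ (moved i j (act_tensor g v) P)"
    proof (rule integ_cong)
      fix y assume y: "y \<in> W"
      show "moved i j v (act_part (iv g) P) (\<alpha> (iv g) y) = moved i j (act_tensor g v) P y"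
        by (simp add: moved_def mem_act_part_iff[OF P gi y] act_part_move[OF P gi y, symmetric]
            act_tensor_apply move_closed[OF P])
    qed
    finally show ?thesis using P gP by (simp add: E_def act_tensor_apply)
  qed (simp add: E_def act_tensor_outside)
qed

text \<open>By equivariance an open subgroup that fixes \<open>v\<close> also fixes its
  image.\<close>

lemma E_closed:
  assumes v: "v \<in> tensors"
  shows "E i j v \<in> tensors"
proof -
  obtain U where U: "opn U" "fixes_tensor U v" by (rule tensorsE[OF v])
  have E0: "\<And>P. P \<notin> parts \<Longrightarrow> E i j v P = 0" by (simp add: E_def)
  have "\<forall>g\<in>U. act_tensor g v = v" using tensor_fixes_iff[OF v U(1)] U(2) by blast
  then have "\<forall>g\<in>U. act_tensor g (E i j v) = E i j v"
    using E_act_tensor[OF v opn_in_G[OF U(1)], of _ i j] by metis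
  then have "fixes_tensor U (E i j v)" using fixes_tensor_iff[of U "E i j v"] E0 U(1) by simp
  then show ?thesis by (intro tensorsI[OF _ U(1)] E0)
qed

lemma E_add:
  assumes "v \<in> tensors" "w \<in> tensors"
  shows "E i j (v + w) = E i j v + E i j w"
proof
  fix P
  have "moved i j (v + w) P = (\<lambda>y. moved i j v P y + moved i j w P y)"
    by (auto simp: moved_def)
  then show "E i j (v + w) P = (E i j v + E i j w) P"
    using assms by (simp add: E_def integ_add smooth_moved)
qed

lemma E_scale:
  assumes "v \<in> tensors"
  shows "E i j (fun_scale c v) = fun_scale c (E i j v)"
proof
  fix P
  have "moved i j (fun_scale c v) P = (\<lambda>y. c * moved i j v P y)"
    by (auto simp: moved_def fun_scale_def)
  then show "E i j (fun_scale c v) P = fun_scale c (E i j v) P"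
    using assms by (simp add: E_def integ_scale smooth_moved fun_scale_def)
qed

section \<open>Products and commutators of the operators\<close>

definition moved2 ::
  "'r \<Rightarrow> 'r \<Rightarrow> 'r \<Rightarrow> 'r \<Rightarrow> (('r \<Rightarrow> 'w set) \<Rightarrow> 'k) \<Rightarrow> ('r \<Rightarrow> 'w set) \<Rightarrow> 'w \<Rightarrow> 'w \<Rightarrow> 'k" where
  "moved2 i j k l v P y z =
     (if y \<in> P i \<and> z \<in> P k \<and> y \<noteq> z then v (move k l z (move i j y P)) else 0)"

text \<open>The symmetry is due to testing \<open>z\<close> against the original \<open>P\<close>
  instead of the moved tuple and to leaving out the diagonal, where the order of the moves
  matters.\<close>

lemma moved2_swap: "moved2 i j k l v P y z = moved2 k l i j v P z y"
  by (auto simp: moved2_def move_commute)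

lemma invariant_moved2:
  assumes U: "opn U" "fixes_tensor U v" "fixes_parts U P" and P: "P \<in> parts"
  shows "invariant2 U (moved2 i j k l v P)"
  unfolding invariant2_def
proof (intro ballI)
  fix g y z assume g: "g \<in> U" and y: "y \<in> W" and z: "z \<in> W"
  note gG = opn_in_G[OF U(1) g] and gP = fixes_partsD[OF U(3) g]
  have mem: "\<alpha> g w \<in> P a \<longleftrightarrow> w \<in> P a" if "w \<in> W" for a w
    using mem_act_part_iff[OF P gG that] gP by metis
  have ne: "\<alpha> g y \<noteq> \<alpha> g z \<longleftrightarrow> y \<noteq> z" using inj_onD[OF act_inj[OF gG]] y z by blast
  have "v (move k l (\<alpha> g z) (move i j (\<alpha> g y) P)) = v (move k l z (move i j y P))"
    if yz: "y \<in> P i" "z \<in> P k" "y \<noteq> z"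
  proof -
    note Q = move_closed[OF P yz(1), of j]
    have "z \<in> move i j y P k" using yz by (simp add: mem_move_iff[OF part_disjoint[OF P] yz(1)])
    then have R: "move k l z (move i j y P) \<in> parts" by (rule move_closed[OF Q])
    have "act_part g (move k l z (move i j y P)) = move k l (\<alpha> g z) (move i j (\<alpha> g y) P)"
      by (simp add: act_part_move[OF Q gG z] act_part_move[OF P gG y] gP)
    then show ?thesis using U(2) g R unfolding fixes_tensor_def by metis
  qed
  then show "moved2 i j k l v P (\<alpha> g y) (\<alpha> g z) = moved2 i j k l v P y z"
    by (simp add: moved2_def mem y z ne)
qed

text \<open>
  The second moved point is either different from the first one, or it is the first one again,
  which has just arrived in the \<open>j\<close>-th part.
\<close>

lemma E_E:
  assumes v: "v \<in> tensors" and P: "P \<in> parts"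
  shows "E i j (E k l v) P =
    integ (\<lambda>y. integ (\<lambda>z. moved2 i j k l v P y z)) + (if k = j then E i l v P else 0)"
proof -
  obtain U where U: "opn U" "fixes_tensor U v" "fixes_parts U P"
    by (rule tensor_part_stabilizer[OF v P])
  note inv2 = invariant_moved2[OF U P, of i j k l]
  let ?d = "\<lambda>y. if k = j then moved i l v P y else 0"
  have d: "smooth_fun ?d" using smooth_moved[OF v P] smooth_fun_const by (cases "k = j") simp_all
  have step: "moved i j (E k l v) P y = integ (moved2 i j k l v P y) + ?d y" if y: "y \<in> W" for y
  proof (cases "y \<in> P i")
    case True
    let ?Q = "move i j y P"
    have Q: "?Q \<in> parts" by (rule move_closed[OF P True])
    note dis = part_disjoint[OF P]
    \<comment> \<open>After the first move \<open>y\<close> lies in part \<open>k\<close> only if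
      \<open>k = j\<close>, and moving it on amounts to one move from \<open>i\<close> to
      \<open>l\<close>. As \<open>{y}\<close> has volume 1, this term integrates to
      \<open>?d y\<close>.\<close>
    have "integ (moved k l v ?Q)
        = integ (\<lambda>z. moved2 i j k l v P y z + (if z \<in> {y} then ?d y else 0))"
    proof (rule integ_cong)
      fix z
      show "moved k l v ?Q z = moved2 i j k l v P y z + (if z \<in> {y} then ?d y else 0)"
        using True by (auto simp: moved_def moved2_def mem_move_iff[OF dis True] move_move[OF dis True])
    qed
    also have "\<dots> = integ (moved2 i j k l v P y) + ?d y"
      using integ_indicator[OF hat_subset_singleton[OF y], of "?d y"] vol_singleton[OF y]
      by (subst integ_add[OF smooth_section[OF U(1) inv2 y]
            smooth_indicator[OF hat_subset_singleton[OF y]]]) (simp only: mult_1_right)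
    finally show ?thesis using True Q by (simp add: moved_def[of i j "E k l v"] E_def)
  next
    case False
    then have "moved2 i j k l v P y = (\<lambda>z. 0)" by (simp add: moved2_def fun_eq_iff)
    then show ?thesis using False by (simp add: moved_def integ_0)
  qed
  have "E i j (E k l v) P = integ (\<lambda>y. integ (moved2 i j k l v P y) + ?d y)"
    using P by (simp only: E_def if_True) (rule integ_cong[OF step])
  also have "\<dots> = integ (\<lambda>y. integ (moved2 i j k l v P y)) + integ ?d"
    using invariant_integ[OF U(1) inv2] U(1) by (intro integ_add d) (auto simp: smooth_fun_def)
  also have "integ ?d = (if k = j then E i l v P else 0)"
    using P by (cases "k = j") (simp_all add: E_def integ_0)
  finally show ?thesis .
qed

text \<open>These are the commutator relations of the elementary matrices, evaluated at
  \<open>P\<close>; the double integrals from \<open>E_E\<close> cancel.\<close>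

lemma E_bracket:
  assumes v: "v \<in> tensors"
  shows "E i j (E k l v) P - E k l (E i j v) P =
    (if k = j then E i l v P else 0) - (if i = l then E k j v P else 0)"
proof (cases "P \<in> parts")
  case P: True
  obtain U where U: "opn U" "fixes_tensor U v" "fixes_parts U P"
    by (rule tensor_part_stabilizer[OF v P])
  have "integ (\<lambda>y. integ (\<lambda>z. moved2 i j k l v P y z))
      = integ (\<lambda>z. integ (\<lambda>y. moved2 k l i j v P z y))"
    using integ_swap[OF U(1) invariant_moved2[OF U P, of i j k l]]
    by (simp add: moved2_swap[of i j k l])
  then show ?thesis by (simp add: E_E[OF v P])
qed (simp add: E_def)

end

section \<open>The action of the matrix Lie algebra\<close>

lemma sum_fun_apply:
  fixes f :: "'i \<Rightarrow> 'w \<Rightarrow> 'k::comm_monoid_add"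
  shows "(\<Sum>i\<in>I. f i) x = (\<Sum>i\<in>I. f i x)"
  by (induction I rule: infinite_finite_induct) simp_all

text \<open>Index bookkeeping alone: \<open>e i j\<close> stands for the value of an operator at a
  fixed tuple. The first conditional term collects to \<open>A ** B\<close> and the second to
  \<open>B ** A\<close>.\<close>

lemma sum_gl_structure_constants:
  fixes A B :: "'k::field^'r^'r" and e :: "'r::finite \<Rightarrow> 'r \<Rightarrow> 'k"
  shows "(\<Sum>i\<in>UNIV. \<Sum>j\<in>UNIV. \<Sum>k\<in>UNIV. \<Sum>l\<in>UNIV. A $ i $ j * B $ k $ l *
      ((if k = j then e i l else 0) - (if i = l then e k j else 0)))
    = (\<Sum>i\<in>UNIV. \<Sum>j\<in>UNIV. gl_bracket A B $ i $ j * e i j)"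
proof -
  have 1: "(\<Sum>k\<in>UNIV. \<Sum>l\<in>UNIV. A $ i $ j * B $ k $ l * (if k = j then e i l else 0))
      = (\<Sum>l\<in>UNIV. A $ i $ j * B $ j $ l * e i l)" for i j
    by (subst sum.swap) (simp add: if_distrib cong: if_cong)
  have 2: "(\<Sum>k\<in>UNIV. \<Sum>l\<in>UNIV. A $ i $ j * B $ k $ l * (if i = l then e k j else 0))
      = (\<Sum>k\<in>UNIV. A $ i $ j * B $ k $ i * e k j)" for i j
    by (simp add: if_distrib cong: if_cong)
  have 3: "(\<Sum>i\<in>UNIV. \<Sum>j\<in>UNIV. \<Sum>l\<in>UNIV. A $ i $ j * B $ j $ l * e i l)
      = (\<Sum>i\<in>UNIV. \<Sum>l\<in>UNIV. (\<Sum>j\<in>UNIV. A $ i $ j * B $ j $ l) * e i l)"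
    by (simp only: sum_distrib_right) (intro sum.cong refl sum.swap)
  have "(\<Sum>i\<in>UNIV. \<Sum>j\<in>UNIV. \<Sum>k\<in>UNIV. A $ i $ j * B $ k $ i * e k j)
      = (\<Sum>j\<in>UNIV. \<Sum>k\<in>UNIV. \<Sum>i\<in>UNIV. B $ k $ i * A $ i $ j * e k j)"
    by (subst sum.swap, subst (2) sum.swap) (simp add: mult.commute)
  also have "\<dots> = (\<Sum>k\<in>UNIV. \<Sum>j\<in>UNIV. (\<Sum>i\<in>UNIV. B $ k $ i * A $ i $ j) * e k j)"
    by (subst sum.swap) (simp only: sum_distrib_right)
  finally have 4: "(\<Sum>i\<in>UNIV. \<Sum>j\<in>UNIV. \<Sum>k\<in>UNIV. A $ i $ j * B $ k $ i * e k j) = \<dots>" .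
  show ?thesis
    by (simp only: right_diff_distrib sum_subtractf 1 2 3 4)
      (simp add: gl_bracket_def matrix_matrix_mult_def left_diff_distrib sum_subtractf)
qed

lemma gl_action_subspace:
  assumes \<rho>: "gl_action V \<rho>" and "module.subspace fun_scale V'" "V' \<subseteq> V"
    and "\<And>A v. v \<in> V' \<Longrightarrow> \<rho> A v \<in> V'"
  shows "gl_action V' \<rho>"
  using assms unfolding gl_action_def subset_iff by simp

context measured_set
begin

definition \<rho> :: "'k^'r^'r \<Rightarrow> (('r::finite \<Rightarrow> 'w set) \<Rightarrow> 'k) \<Rightarrow> ('r \<Rightarrow> 'w set) \<Rightarrow> 'k" where
  "\<rho> A v = (\<Sum>i\<in>UNIV. \<Sum>j\<in>UNIV. fun_scale (A $ i $ j) (E i j v))"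

lemma \<rho>_apply: "\<rho> A v P = (\<Sum>i\<in>UNIV. \<Sum>j\<in>UNIV. A $ i $ j * E i j v P)"
  by (simp add: \<rho>_def sum_fun_apply fun_scale_def)

lemma \<rho>_elementary: "\<rho> (elementary_matrix i j) v = E i j v"
proof
  fix P
  have "elementary_matrix i j $ a $ b * E a b v P
      = (if b = j then if a = i then E a j v P else 0 else 0)" for a b
    by (simp add: elementary_matrix_def)
  then show "\<rho> (elementary_matrix i j) v P = E i j v P"
    by (simp add: \<rho>_apply)
qed

lemma subspace_tensors: "module.subspace fun_scale (tensors :: (('r::finite \<Rightarrow> 'w set) \<Rightarrow> 'k) set)"
proof (rule module.subspaceI[OF module_fun_scale])
  show "(0 :: ('r \<Rightarrow> 'w set) \<Rightarrow> 'k) \<in> tensors"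
    by (rule tensorsI[OF _ opn_G]) (simp_all add: fixes_tensor_def)
next
  fix v w :: "('r \<Rightarrow> 'w set) \<Rightarrow> 'k" assume v: "v \<in> tensors" and w: "w \<in> tensors"
  obtain U where U: "opn U" "fixes_tensor U v" by (rule tensorsE[OF v])
  obtain V where V: "opn V" "fixes_tensor V w" by (rule tensorsE[OF w])
  show "v + w \<in> tensors"
    by (rule tensorsI[OF _ opn_Int[OF U(1) V(1)]])
      (use U(2) V(2) tensor_outside[OF v] tensor_outside[OF w] in \<open>simp_all add: fixes_tensor_def\<close>)
next
  fix c and v :: "('r \<Rightarrow> 'w set) \<Rightarrow> 'k" assume v: "v \<in> tensors"
  obtain U where U: "opn U" "fixes_tensor U v" by (rule tensorsE[OF v])
  show "fun_scale c v \<in> tensors"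
    by (rule tensorsI[OF _ U(1)])
      (use U(2) tensor_outside[OF v] in \<open>simp_all add: fixes_tensor_def fun_scale_def\<close>)
qed

lemma \<rho>_closed: "v \<in> tensors \<Longrightarrow> \<rho> A v \<in> tensors"
  unfolding \<rho>_def
  by (intro module.subspace_sum[OF module_fun_scale subspace_tensors]
      module.subspace_scale[OF module_fun_scale subspace_tensors] E_closed)

text \<open>Additivity of the operators rests on that of the integral, which is proved for smooth
  integrands; hence the summands have to be tensors.\<close>

lemma E_sum:
  fixes f :: "'i \<Rightarrow> ('r::finite \<Rightarrow> 'w set) \<Rightarrow> 'k"
  assumes "\<And>a. a \<in> I \<Longrightarrow> f a \<in> tensors"
  shows "E i j (\<Sum>a\<in>I. f a) = (\<Sum>a\<in>I. E i j (f a))"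
proof -
  have 0: "(0 :: ('r \<Rightarrow> 'w set) \<Rightarrow> 'k) \<in> tensors"
    by (rule module.subspace_0[OF module_fun_scale subspace_tensors])
  have E0: "E i j (0 :: ('r \<Rightarrow> 'w set) \<Rightarrow> 'k) = 0"
    using E_add[OF 0 0, of i j] by simp
  show ?thesis
    using assms
  proof (induction I rule: infinite_finite_induct)
    case (insert a I)
    have "(\<Sum>a\<in>I. f a) \<in> tensors"
      using insert.prems by (intro module.subspace_sum[OF module_fun_scale subspace_tensors]) auto
    then have "E i j (f a + (\<Sum>a\<in>I. f a)) = E i j (f a) + E i j (\<Sum>a\<in>I. f a)"
      using insert.prems by (intro E_add) auto
    also have "E i j (\<Sum>a\<in>I. f a) = (\<Sum>a\<in>I. E i j (f a))"
      using insert.prems by (intro insert.IH) auto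
    finally show ?case by (simp only: sum.insert[OF insert.hyps])
  qed (simp_all add: E0)
qed

lemma E_\<rho>:
  assumes v: "v \<in> tensors"
  shows "E i j (\<rho> B v) P = (\<Sum>k\<in>UNIV. \<Sum>l\<in>UNIV. B $ k $ l * E i j (E k l v) P)"
proof -
  note sub = module.subspace_sum[OF module_fun_scale subspace_tensors]
    module.subspace_scale[OF module_fun_scale subspace_tensors]
  have "E i j (\<rho> B v) = (\<Sum>k\<in>UNIV. \<Sum>l\<in>UNIV. fun_scale (B $ k $ l) (E i j (E k l v)))"
    unfolding \<rho>_def by (simp add: E_sum sub E_closed[OF v] E_scale)
  then show ?thesis by (simp add: sum_fun_apply fun_scale_def)
qed

lemma \<rho>_bracket:
  assumes v: "v \<in> tensors"
  shows "\<rho> (gl_bracket A B) v = \<rho> A (\<rho> B v) - \<rho> B (\<rho> A v)"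
proof
  fix P
  let ?e = "\<lambda>i j k l. E i j (E k l v) P"
  have "\<rho> A (\<rho> B v) P = (\<Sum>i\<in>UNIV. \<Sum>j\<in>UNIV. \<Sum>k\<in>UNIV. \<Sum>l\<in>UNIV. A $ i $ j * B $ k $ l * ?e i j k l)"
    by (simp add: \<rho>_apply[of A] E_\<rho>[OF v] sum_distrib_left mult.assoc)
  moreover have "\<rho> B (\<rho> A v) P =
      (\<Sum>k\<in>UNIV. \<Sum>l\<in>UNIV. \<Sum>i\<in>UNIV. \<Sum>j\<in>UNIV. A $ i $ j * B $ k $ l * ?e k l i j)"
    by (simp add: \<rho>_apply[of B] E_\<rho>[OF v] sum_distrib_left mult.assoc mult.left_commute)
  \<comment> \<open>The sums over \<open>k\<close> and \<open>l\<close> become the inner ones, so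
    that the two fourfold sums can be subtracted term by term.\<close>
  moreover have "\<dots> = (\<Sum>i\<in>UNIV. \<Sum>j\<in>UNIV. \<Sum>k\<in>UNIV. \<Sum>l\<in>UNIV. A $ i $ j * B $ k $ l * ?e k l i j)"
    unfolding sum.cartesian_product
    by (rule sum.reindex_bij_witness[where i = "\<lambda>(i, j, k, l). (k, l, i, j)" and j = "\<lambda>(k, l, i, j). (i, j, k, l)"]) auto
  ultimately have "\<rho> A (\<rho> B v) P - \<rho> B (\<rho> A v) P =
      (\<Sum>i\<in>UNIV. \<Sum>j\<in>UNIV. \<Sum>k\<in>UNIV. \<Sum>l\<in>UNIV. A $ i $ j * B $ k $ l * (?e i j k l - ?e k l i j))"
    by (simp only: right_diff_distrib sum_subtractf)
  also have "\<dots> = (\<Sum>i\<in>UNIV. \<Sum>j\<in>UNIV. gl_bracket A B $ i $ j * E i j v P)"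
    unfolding E_bracket[OF v] by (rule sum_gl_structure_constants)
  finally show "\<rho> (gl_bracket A B) v P = (\<rho> A (\<rho> B v) - \<rho> B (\<rho> A v)) P"
    by (simp add: \<rho>_apply[of "gl_bracket A B"])
qed

lemma gl_action_tensors: "gl_action (tensors :: (('r::finite \<Rightarrow> 'w set) \<Rightarrow> 'k) set) \<rho>"
  unfolding gl_action_def
proof (intro conjI allI ballI)
  fix A B :: "'k^'r^'r" and c and v w :: "('r \<Rightarrow> 'w set) \<Rightarrow> 'k"
  assume v: "v \<in> tensors"
  show "\<rho> A (v + w) = \<rho> A v + \<rho> A w" if "w \<in> tensors"
    by (rule ext) (simp add: \<rho>_apply E_add[OF v that] distrib_left sum.distrib)
  show "\<rho> A (fun_scale c v) = fun_scale c (\<rho> A v)"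
    by (rule ext, simp only: \<rho>_apply E_scale[OF v])
      (simp add: \<rho>_apply fun_scale_def sum_distrib_left mult.left_commute)
  show "\<rho> (A + B) v = \<rho> A v + \<rho> B v"
    by (rule ext) (simp add: \<rho>_apply distrib_right sum.distrib)
  show "\<rho> (mat_scale c A) v = fun_scale c (\<rho> A v)"
    by (rule ext) (simp add: \<rho>_apply mat_scale_def fun_scale_def sum_distrib_left mult.assoc)
qed (simp_all add: subspace_tensors \<rho>_closed \<rho>_bracket)

lemma \<rho>_act_tensor:
  assumes v: "v \<in> tensors" and g: "g \<in> G"
  shows "\<rho> A (act_tensor g v) = act_tensor g (\<rho> A v)"
proof
  fix P
  show "\<rho> A (act_tensor g v) P = act_tensor g (\<rho> A v) P"
    by (cases "P \<in> parts")
      (simp_all add: \<rho>_apply E_act_tensor[OF v g] act_tensor_apply act_tensor_outside)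
qed

text \<open>Since \<open>\<rho>\<close> commutes with \<open>G\<close>, it preserves the invariants,
  and a preserved subspace inherits the identities of an action.\<close>

lemma gl_action_invariants:
  "gl_action (tensor_invariants X G W \<alpha> :: (('r::finite \<Rightarrow> 'w set) \<Rightarrow> 'k) set) \<rho>"
proof (rule gl_action_subspace[OF gl_action_tensors])
  note M = module_fun_scale and S = subspace_tensors
  show "module.subspace fun_scale
      (tensor_invariants X G W \<alpha> :: (('r \<Rightarrow> 'w set) \<Rightarrow> 'k) set)"
  proof (rule module.subspaceI[OF M])
    fix c and v w :: "('r \<Rightarrow> 'w set) \<Rightarrow> 'k"
    assume v: "v \<in> tensor_invariants X G W \<alpha>"
    have "act_tensor g (fun_scale c v) = fun_scale c (act_tensor g v)" for g
      by (auto simp: tensor_action_def fun_action_def fun_scale_def)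
    then show "fun_scale c v \<in> tensor_invariants X G W \<alpha>"
      using v module.subspace_scale[OF M S] by (auto simp: tensor_invariants_def)
    assume w: "w \<in> tensor_invariants X G W \<alpha>"
    have "act_tensor g (v + w) = act_tensor g v + act_tensor g w" for g
      by (auto simp: tensor_action_def fun_action_def)
    then show "v + w \<in> tensor_invariants X G W \<alpha>"
      using v w module.subspace_add[OF M S] by (auto simp: tensor_invariants_def)
  qed (use module.subspace_0[OF M S] in
    \<open>auto simp: tensor_invariants_def tensor_action_def fun_action_def\<close>)
next
  fix A :: "'k^'r^'r" and v :: "('r \<Rightarrow> 'w set) \<Rightarrow> 'k"
  assume "v \<in> tensor_invariants X G W \<alpha>"
  then show "\<rho> A v \<in> tensor_invariants X G W \<alpha>"
    using \<rho>_closed[of v A] \<rho>_act_tensor[of v _ A] by (simp add: tensor_invariants_def)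
qed (auto simp: tensor_invariants_def)

end

theorem theorem4p9:
  fixes X :: "'x set" and G :: "('x \<Rightarrow> 'x) set"
    and \<mu> :: "('x, 'k::field) ghat_function"
    and Y :: "'y set" and \<psi> :: "('x \<Rightarrow> 'x) \<Rightarrow> 'y \<Rightarrow> 'y"
  assumes "oligomorphic X G"
    and "ghat_measure X G \<mu>"
    and "ghat_set X G G Y \<psi>"
  shows
    "(\<forall>(i::'r::finite) j. \<forall>v \<in> tensor_power X G Y \<psi>.
        (\<forall>P \<in> Part X G Y \<psi>.
           (\<forall>U. open_subgroup X G U \<and> stable_under U \<psi> (P i)
                  \<longrightarrow> finite (orbits (perm_group X U) (P i) \<psi>)) \<and>
           (\<exists>!c. E_value X G \<mu> Y \<psi> i j v P c)) \<and>
        E_op X G \<mu> Y \<psi> i j v \<in> tensor_power X G Y \<psi>) \<and>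
     (\<exists>\<rho> :: 'k^'r^'r \<Rightarrow> (('r \<Rightarrow> 'y set) \<Rightarrow> 'k) \<Rightarrow> (('r \<Rightarrow> 'y set) \<Rightarrow> 'k).
        (\<forall>i j. \<forall>v \<in> tensor_power X G Y \<psi>.
           \<rho> (elementary_matrix i j) v = E_op X G \<mu> Y \<psi> i j v) \<and>
        gl_action (tensor_power X G Y \<psi>) \<rho> \<and>
        (\<forall>A. \<forall>g\<in>G. \<forall>v \<in> tensor_power X G Y \<psi>.
           \<rho> A (tensor_action X G Y \<psi> g v) = tensor_action X G Y \<psi> g (\<rho> A v)) \<and>
        gl_action (tensor_invariants X G Y \<psi>) \<rho>)"
proof -
  interpret measured_set X G \<mu> Y \<psi>
    using assms
    by (intro measured_set.intro measured_group.intro oligomorphic_group.intro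
        smooth_set.intro smooth_set_axioms.intro)
  show ?thesis
  proof (intro conjI allI ballI impI exI[of _ \<rho>])
    fix i j :: 'r and v :: "('r \<Rightarrow> 'y set) \<Rightarrow> 'k" and P :: "'r \<Rightarrow> 'y set"
    assume v: "v \<in> tensor_power X G Y \<psi>" and P: "P \<in> Part X G Y \<psi>"
    \<comment> \<open>Over an infinite set of orbits the sum in \<open>E_value\<close> would be 0 by
      convention; finiteness ensures that it is the sum meant.\<close>
    show "finite (orbits (perm_group X U) (P i) \<psi>)"
      if "open_subgroup X G U \<and> stable_under U \<psi> (P i)" for U
      using that part_subset[OF P] by (intro finite_orbits_subset) auto
    show "\<exists>!c. E_value X G \<mu> Y \<psi> i j v P c"
      by (simp add: E_value_iff[OF v P])
  qed (simp_all add: E_op_eq E_closed \<rho>_elementary gl_action_tensors \<rho>_act_tensor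
      gl_action_invariants)
qed

end
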